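(* Let $k\geq 2$, $m\geq 4$ and $t\geq 0$ be integers. The $k$-graph $\mathcal{L}^{(k)}_{m,t}$ is the unique (up to isomorphism) maximizing $k$-graph in $\mathfrak{LCa}_k(m,t)$.
   Context: A $k$-graph is a finite vertex set with a set of $k$-element subsets (edges). $\mu(\mathcal{H},x)=\sum_{r\ge0}(-1)^r p(\mathcal{H},r)x^{|V(\mathcal{H})|-kr}$ with $p(\mathcal{H},r)$ the number of $r$-matchings; $\lambda(\mathcal{H})$ is the maximum modulus of its zeros; a member of a family is maximizing if its $\lambda$ is maximum in the family. A path is an alternating sequence $(v_0,e_1,v_1,\dots,e_\ell,v_\ell)$ of vertices and pairwise distinct edges with $v_{i-1},v_i\in e_i$ and $v_0,\dots,v_\ell$ pairwise distinct; it is a cycle if instead $v_1,\dots,v_\ell$ are pairwise distinct, $\ell\ge2$ and $v_0=v_\ell$, viewed as the subgraph with those edges, $V(\cdot)=\bigcup_ie_i$. A $k$-cactus is a connected $k$-graph in which any two distinct cycles share at most one vertex; a $k$-graph is linear if any two distinct edges share at most one vertex. $\mathfrak{LCa}_k(m,t)$ is the set of linear $k$-cacti with $m$ edges and $t$ cycles. $\mathcal{L}^{(k)}_{m,t}$ (defined for $m\ge3t$): take a vertex $u$; add $t$ linear cycles of length $3$, the $i$-th with edges $g_{i,1},g_{i,2},g_{i,3}$ where $g_{i,1}\cap g_{i,2}=\{a_i\}$, $g_{i,2}\cap g_{i,3}=\{b_i\}$, $g_{i,3}\cap g_{i,1}=\{u\}$, and $m-3t$ edges each consisting of $u$ and $k-1$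 new vertices; different cycles share only $u$ and all remaining vertices have degree one. *)

theory Defs
  imports Complex_Main "HOL-Computational_Algebra.Polynomial"
begin

datatype 'a hypergraph = Hypergraph (verts: "'a set") (edges: "'a set set")

definition kgraph :: "nat \<Rightarrow> 'a hypergraph \<Rightarrow> bool" where
  "kgraph k H \<longleftrightarrow> finite (verts H) \<and> (\<forall>e\<in>edges H. e \<subseteq> verts H \<and> card e = k)"

definition isomorphic :: "'a hypergraph \<Rightarrow> 'b hypergraph \<Rightarrow> bool" where
  "isomorphic H G \<longleftrightarrow>
     (\<exists>f. bij_betw f (verts H) (verts G) \<and> (\<lambda>e. f ` e) ` edges H = edges G)"


definition matchings :: "'a hypergraph \<Rightarrow> nat \<Rightarrow> 'a set set set" where
  "matchings H r = {M. M \<subseteq> edges H \<and> card M = r \<and> pairwise disjnt M}"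

(* In a k-graph with k >= 1 there is no r-matching with r > card (edges H) or
   k * r > card (verts H), so neither the finite range of summation nor the truncated
   subtraction in the exponent affects the sum over all r >= 0. *)
definition matching_poly :: "nat \<Rightarrow> 'a hypergraph \<Rightarrow> complex poly" where
  "matching_poly k H =
     (\<Sum>r\<le>card (edges H).
        monom ((-1) ^ r * of_nat (card (matchings H r))) (card (verts H) - k * r))"

definition max_root :: "nat \<Rightarrow> 'a hypergraph \<Rightarrow> real" where
  "max_root k H = Max (cmod ` {z. poly (matching_poly k H) z = 0})"

definition maximizing :: "nat \<Rightarrow> 'a hypergraph set \<Rightarrow> 'a hypergraph \<Rightarrow> bool" where
  "maximizing k F H \<longleftrightarrow> H \<in> F \<and> (\<forall>G\<in>F. max_root k G \<le> max_root k H)"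


(* The sequence (v_0, e_1, v_1, ..., e_l, v_l) is given by vs = [v_0, ..., v_l] and
   es = [e_1, ..., e_l]; thus es ! i is e_(i+1). *)
definition alternating :: "'a hypergraph \<Rightarrow> 'a list \<Rightarrow> 'a set list \<Rightarrow> bool" where
  "alternating H vs es \<longleftrightarrow>
     length vs = length es + 1 \<and> set vs \<subseteq> verts H \<and> set es \<subseteq> edges H \<and> distinct es \<and>
     (\<forall>i<length es. vs ! i \<in> es ! i \<and> vs ! Suc i \<in> es ! i)"

definition is_path :: "'a hypergraph \<Rightarrow> 'a list \<Rightarrow> 'a set list \<Rightarrow> bool" where
  "is_path H vs es \<longleftrightarrow> alternating H vs es \<and> distinct vs"

definition is_cycle :: "'a hypergraph \<Rightarrow> 'a list \<Rightarrow> 'a set list \<Rightarrow> bool" where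
  "is_cycle H vs es \<longleftrightarrow>
     alternating H vs es \<and> distinct (tl vs) \<and> 2 \<le> length es \<and> hd vs = last vs"

(* Cycles are counted and compared as subgraphs, not as sequences. *)
definition cycles :: "'a hypergraph \<Rightarrow> 'a hypergraph set" where
  "cycles H = {Hypergraph (\<Union>(set es)) (set es) | vs es. is_cycle H vs es}"

definition connected_hypergraph :: "'a hypergraph \<Rightarrow> bool" where
  "connected_hypergraph H \<longleftrightarrow>
     verts H \<noteq> {} \<and>
     (\<forall>u\<in>verts H. \<forall>v\<in>verts H. \<exists>vs es. is_path H vs es \<and> hd vs = u \<and> last vs = v)"

definition kcactus :: "nat \<Rightarrow> 'a hypergraph \<Rightarrow> bool" where
  "kcactus k H \<longleftrightarrow> kgraph k H \<and> connected_hypergraph H \<and>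
     (\<forall>C\<in>cycles H. \<forall>D\<in>cycles H. C \<noteq> D \<longrightarrow> card (verts C \<inter> verts D) \<le> 1)"

definition linear_hypergraph :: "'a hypergraph \<Rightarrow> bool" where
  "linear_hypergraph H \<longleftrightarrow>
     (\<forall>e\<in>edges H. \<forall>f\<in>edges H. e \<noteq> f \<longrightarrow> card (e \<inter> f) \<le> 1)"

definition LCa :: "nat \<Rightarrow> nat \<Rightarrow> nat \<Rightarrow> 'a hypergraph set" where
  "LCa k m t = {H. kcactus k H \<and> linear_hypergraph H \<and>
                   card (edges H) = m \<and> card (cycles H) = t}"


(* VertU, VertA i, VertB i are u, a_i, b_i; the remaining vertices of degree one are CycleLeaf i j l in
   the edge g_(i,j), and PendantLeaf i l in the i-th edge off the cycles. *)
datatype Lvertex = VertU | VertA nat | VertB nat | CycleLeaf nat nat nat | PendantLeaf nat nat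

definition L_cycle :: "nat \<Rightarrow> nat \<Rightarrow> Lvertex set set" where
  "L_cycle k i =
     {{VertU, VertA i} \<union> CycleLeaf i 1 ` {..<k - 2},
      {VertA i, VertB i} \<union> CycleLeaf i 2 ` {..<k - 2},
      {VertB i, VertU} \<union> CycleLeaf i 3 ` {..<k - 2}}"

definition L_edges :: "nat \<Rightarrow> nat \<Rightarrow> nat \<Rightarrow> Lvertex set set" where
  "L_edges k m t =
     (\<Union>i<t. L_cycle k i) \<union> (\<lambda>i. {VertU} \<union> PendantLeaf i ` {..<k - 1}) ` {..<m - 3 * t}"

(* Meaningful for k >= 2 and m >= 3 * t. *)
definition L_graph :: "nat \<Rightarrow> nat \<Rightarrow> nat \<Rightarrow> Lvertex hypergraph" where
  "L_graph k m t = Hypergraph ({VertU} \<union> \<Union>(L_edges k m t)) (L_edges k m t)"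

end

theory Submission
  imports Defs "HOL-Computational_Algebra.Fundamental_Theorem_Algebra"
begin

text \<open>
  Write \<open>F\<^sub>E(w) = \<Sum>\<^sub>M (-w)\<^bsup>|M|\<^esup>\<close>, the sum running over the matchings \<open>M \<subseteq> E\<close>; then
  \<open>\<mu>(H, x) = x\<^sup>n F\<^sub>E(x\<^bsup>-k\<^esup>)\<close>. If \<open>F\<^sub>A(b) > 0\<close> for all \<open>A \<subseteq> E\<close>, then \<open>F\<^sub>E\<close> has no complex zero of modulus
  at most \<open>b\<close>, because \<open>|F\<^sub>A(w)| / |F\<^bsub>A \<inter> B\<^esub>(w)| \<ge> F\<^sub>E(b) / F\<^sub>B(b)\<close> for \<open>|w| \<le> b\<close>.

  A linear cactus arises by gluing single edges and cycles one at a time at one vertex \<open>r\<close> each.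
  By induction along this construction, \<open>t\<close> pairwise disjoint edges avoid any prescribed vertex, so that
  \<open>F\<^bsub>E + e\<^esub>(z) = F\<^sub>E(z) - z F\<^bsub>E - N[e]\<^esub>(z)\<close> drops by at most \<open>z (1 - z)\<^sup>t\<close> when an edge is glued;
  when a cycle is glued, its first edge is chosen to avoid \<open>r\<close> and costs a factor \<open>1 - z\<close>, and only its two
  neighbours on the cycle can cost \<open>z (1 - z)\<^sup>t\<close> instead of \<open>z (1 - z)\<^bsup>t+1\<^esup>\<close>. The sum of these estimates is the
  value of \<open>F\<close> for the extremal cactus. Equality in the last gluing step already forces a vertex that at
  most \<open>t\<close> edges avoid, and such a vertex makes the cactus isomorphic to the extremal one.
\<close>

section \<open>The signed matching generating function\<close>

text \<open>Under \<open>w = x^(-k)\<close> the root of largest modulus becomes the zero of least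
  modulus, and all complex roots count, so a comparison on the real axis alone would not do.
  Deleting an edge together with its neighbours leads to arbitrary subfamilies; therefore
  \<open>good\<close> asks for positivity on all of them, and this at a single real point controls a
  whole closed disc. The comparison point is the first positive zero \<beta> of \<open>gap\<close>.
  The form of \<open>gap\<close> comes from expanding the extremal cactus at its centre: without
  edges at the centre the t opposite edges give \<open>(1 - z)^t\<close>, each of the 2t cycle edges
  at the centre blocks one opposite edge and costs \<open>z * (1 - z)^(t - 1)\<close>, and each of
  the m - 3t pendant edges costs \<open>z * (1 - z)^t\<close>. At \<beta> itself a competitor may
  vanish. All its earlier stages still have positive \<open>gap\<close> there and are good; hence
  only the last gluing step has to be examined for strictness, and strict positivity at \<beta>
  means a strictly smaller largest root.\<close>

definition mats :: "'a set set \<Rightarrow> 'a set set set" where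
  "mats E = {M. M \<subseteq> E \<and> pairwise disjnt M}"

text \<open>In other terms, the independence polynomial of the intersection graph of
  \<open>E\<close>, evaluated at \<open>-w\<close>. The value type is left open because positivity
  is used over the reals and zeros are sought over the complex numbers.\<close>

definition mgen :: "'a set set \<Rightarrow> 'b::real_normed_field \<Rightarrow> 'b" where
  "mgen E w = (\<Sum>M\<in>mats E. (- w) ^ card M)"

definition away :: "'a set set \<Rightarrow> 'a set \<Rightarrow> 'a set set" where
  "away E e = {f \<in> E. disjnt e f}"

text \<open>Shearer's condition from the Lovasz local lemma, for the intersection graph of
  \<open>E\<close> with all weights equal to \<open>b\<close>.\<close>

definition good :: "'a set set \<Rightarrow> real \<Rightarrow> bool" where
  "good E b \<longleftrightarrow> (\<forall>A\<subseteq>E. mgen A b > 0)"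

lemma finite_mats: "finite E \<Longrightarrow> finite (mats E)"
  by (rule finite_subset[of _ "Pow E"]) (auto simp: mats_def)

lemma away_subset: "away E e \<subseteq> E"
  by (auto simp: away_def)

lemma finite_away: "finite E \<Longrightarrow> finite (away E e)"
  by (rule finite_subset[OF away_subset])

lemma mats_empty [simp]: "mats {} = {{}}"
  by (auto simp: mats_def)

lemma mgen_empty [simp]: "mgen {} w = 1"
  by (simp add: mgen_def)

lemma mats_insert:
  assumes "e \<notin> E"
  shows "mats (insert e E) = mats E \<union> insert e ` mats (away E e)"
proof
  show "mats (insert e E) \<subseteq> mats E \<union> insert e ` mats (away E e)"
  proof
    fix M assume M: "M \<in> mats (insert e E)"
    show "M \<in> mats E \<union> insert e ` mats (away E e)"
    proof (cases "e \<in> M")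
      case True
      have "M - {e} \<in> mats (away E e)"
        using M True by (auto simp: mats_def away_def pairwise_def)
      moreover have "M = insert e (M - {e})" using True by auto
      ultimately show ?thesis by blast
    qed (use M in \<open>auto simp: mats_def\<close>)
  qed
  show "mats E \<union> insert e ` mats (away E e) \<subseteq> mats (insert e E)"
    by (auto simp: mats_def away_def pairwise_def disjnt_sym)
qed

lemma mgen_insert:
  assumes "finite E" "e \<notin> E"
  shows "mgen (insert e E) w = mgen E w - w * mgen (away E e) w"
proof -
  have e: "e \<notin> M" if "M \<in> mats (away E e)" for M
    using that assms(2) by (auto simp: mats_def away_def)
  have fin: "finite M" if "M \<in> mats (away E e)" for M
    using that assms(1) finite_away finite_subset by (fastforce simp: mats_def)
  have inj: "inj_on (insert e) (mats (away E e))"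
    by (intro inj_onI) (metis e insert_ident)
  have "mgen (insert e E) w =
      mgen E w + (\<Sum>M\<in>insert e ` mats (away E e). (- w) ^ card M)"
    unfolding mgen_def mats_insert[OF assms(2)]
    by (rule sum.union_disjoint) (use assms in \<open>auto simp: finite_mats finite_away mats_def\<close>)
  also have "(\<Sum>M\<in>insert e ` mats (away E e). (- w) ^ card M) =
      (\<Sum>M\<in>mats (away E e). - w * (- w) ^ card M)"
    by (subst sum.reindex[OF inj]) (auto intro!: sum.cong simp: e fin)
  also have "\<dots> = - w * mgen (away E e) w"
    by (simp add: mgen_def sum_distrib_left)
  finally show ?thesis by simp
qed

text \<open>Every subset of \<open>S\<close> is a matching here, so this is the binomial theorem;
  the induction sees it as \<open>away S e = S\<close>.\<close>

lemma mgen_matching: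
  assumes "finite S" "pairwise disjnt S"
  shows "mgen S w = (1 - w) ^ card S"
  using assms
proof (induction S rule: finite_induct)
  case (insert e S)
  have "away S e = S"
    using insert.hyps insert.prems by (auto simp: away_def pairwise_def)
  then show ?case
    using insert by (simp add: mgen_insert pairwise_insert algebra_simps)
qed simp

lemma good_subset: "good E b \<Longrightarrow> A \<subseteq> E \<Longrightarrow> good A b"
  unfolding good_def by blast

lemma good_pos: "good E b \<Longrightarrow> A \<subseteq> E \<Longrightarrow> mgen A b > 0"
  unfolding good_def by blast

text \<open>Each edge added to \<open>A\<close> subtracts \<open>b\<close> times the value of a
  subfamily of \<open>B\<close>, and goodness makes this value positive.\<close>

lemma mgen_antimono_strict:
  assumes "finite B" "good B b" "0 < b" "A \<subset> B"
  shows "mgen B b < mgen A b"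
proof -
  have "X \<noteq> {} \<Longrightarrow> A \<inter> X = {} \<Longrightarrow> good (A \<union> X) b \<Longrightarrow> mgen (A \<union> X) b < mgen A b"
    if "finite X" "finite A" for X
    using that(1)
  proof (induction X rule: finite_induct)
    case (insert e X)
    have g: "good (A \<union> X) b"
      using insert.prems(3) by (rule good_subset) auto
    have "mgen (A \<union> X) b \<le> mgen A b"
      using insert g by (cases "X = {}") auto
    moreover have "0 < b * mgen (away (A \<union> X) e) b"
      using assms(3) good_pos[OF g away_subset] by simp
    ultimately show ?case
      using insert that(2) by (simp add: mgen_insert)
  qed simp
  from this[of "B - A"] show ?thesis
    using assms finite_subset[of A B] by (auto simp: Un_absorb1 psubset_imp_subset)
qed

lemma mgen_antimono:
  assumes "finite B" "good B b" "0 < b" "A \<subseteq> B"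
  shows "mgen B b \<le> mgen A b"
  using mgen_antimono_strict[OF assms(1-3), of A] assms(4) by (cases "A = B") (simp_all add: psubset_eq less_imp_le)

text \<open>Products replace quotients because the values at \<open>w\<close> are not yet known to
  be nonzero. One edge \<open>e\<close> outside \<open>B\<close> is removed from \<open>E\<close> at
  a time: the induction hypothesis, with \<open>away E0 e\<close> in the role of \<open>B\<close>,
  controls the term that \<open>e\<close> subtracts at \<open>w\<close>, and the one-edge estimates
  telescope.\<close>

lemma mgen_ratio:
  fixes w :: "'b::real_normed_field"
  assumes "finite E" "good E b" "0 < b" "norm w \<le> b" "A \<subseteq> E" "B \<subseteq> E"
  shows "norm (mgen (A \<inter> B) w) * mgen E b \<le> norm (mgen A w) * mgen B b"
  using assms(1,2,5,6)
proof (induction E arbitrary: A B rule: finite_psubset_induct)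
  case (psubset E)
  show ?case
  proof (cases "B = E")
    case True
    then show ?thesis using psubset.prems by (simp add: Int_absorb2)
  next
    case False
    then obtain e where e: "e \<in> E" "e \<notin> B" using psubset.prems by auto
    define E0 where "E0 = E - {e}"
    define A0 where "A0 = A - {e}"
    have E: "E = insert e E0" "e \<notin> E0" "finite E0" "E0 \<subset> E" "B \<subseteq> E0" "A0 \<subseteq> E0"
      using e psubset E0_def A0_def by auto
    have g0: "good E0 b" using good_subset[OF psubset.prems(1)] E(4) by blast
    note IH = psubset.IH[OF E(4) g0 E(6)]
    \<comment> \<open>The estimate for the removal of \<open>e\<close> alone; if \<open>e\<close> is
      not in \<open>A\<close>, only the real side changes, by antimonotonicity.\<close>
    have key: "norm (mgen A0 w) * mgen E b \<le> norm (mgen A w) * mgen E0 b"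
    proof (cases "e \<in> A")
      case False
      then have "A0 = A" by (simp add: A0_def)
      moreover have "mgen E b \<le> mgen E0 b"
        using mgen_antimono[OF psubset.hyps(1) psubset.prems(1) assms(3)] E(4) by blast
      ultimately show ?thesis by (simp add: mult_left_mono)
    next
      case True
      then have A: "A = insert e A0" "e \<notin> A0" "finite A0"
        using True finite_subset[OF E(6,3)] by (auto simp: A0_def)
      have "A0 \<inter> away E0 e = away A0 e" using E by (auto simp: away_def)
      then have IH1: "norm (mgen (away A0 e) w) * mgen E0 b \<le> norm (mgen A0 w) * mgen (away E0 e) b"
        using IH[OF away_subset[of E0 e]] by simp
      have pos: "mgen E0 b > 0" using g0 by (rule good_pos) simp
      have "norm (mgen A0 w) - b * norm (mgen (away A0 e) w)
          \<le> norm (mgen A0 w) - norm (w * mgen (away A0 e) w)"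
        using assms(4) by (simp add: norm_mult mult_right_mono)
      also have "\<dots> \<le> norm (mgen A w)"
        unfolding A(1) mgen_insert[OF A(3,2)] by (rule norm_triangle_ineq2)
      finally have "(norm (mgen A0 w) - b * norm (mgen (away A0 e) w)) * mgen E0 b
          \<le> norm (mgen A w) * mgen E0 b"
        using pos by (simp add: mult_right_mono)
      moreover have "b * (norm (mgen (away A0 e) w) * mgen E0 b)
          \<le> b * (norm (mgen A0 w) * mgen (away E0 e) b)"
        using IH1 assms(3) by (simp add: mult_left_mono)
      ultimately show ?thesis
        unfolding E(1) mgen_insert[OF E(3,2)] by (simp add: algebra_simps)
    qed
    have "A0 \<inter> B = A \<inter> B" using e A0_def by auto
    then have IH2: "norm (mgen (A \<inter> B) w) * mgen E0 b \<le> norm (mgen A0 w) * mgen B b"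
      using IH[OF E(5)] by simp
    have pos: "mgen E0 b > 0" "mgen B b > 0" "mgen E b > 0"
      using good_pos[OF psubset.prems(1)] E psubset.prems by auto
    have "norm (mgen (A \<inter> B) w) * mgen E b * mgen E0 b \<le> norm (mgen A0 w) * mgen B b * mgen E b"
      using mult_right_mono[OF IH2, of "mgen E b"] pos by (simp add: mult_ac)
    also have "\<dots> \<le> norm (mgen A w) * mgen E0 b * mgen B b"
      using mult_right_mono[OF key, of "mgen B b"] pos by (simp add: mult_ac)
    finally show ?thesis using pos(1) by (simp add: mult_ac)
  qed
qed

text \<open>The case \<open>A = E\<close>, \<open>B = {}\<close> of \<open>mgen_ratio\<close> reads
  \<open>norm (mgen E w) >= mgen E b\<close>.\<close>

lemma mgen_nonzero:
  fixes w :: "'b::real_normed_field"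
  assumes "finite E" "good E b" "0 < b" "norm w \<le> b"
  shows "mgen E w \<noteq> 0"
  using mgen_ratio[OF assms order_refl, of "{}"] good_pos[OF assms(2) order_refl] by auto

text \<open>A single new inequality suffices: for \<open>A\<close> containing \<open>e\<close>,
  \<open>mgen_ratio\<close> inside \<open>E\<close> shows that \<open>e\<close> reduces the value of
  \<open>A - {e}\<close> by no larger a proportion than it reduces that of \<open>E\<close>.\<close>

lemma good_insert:
  assumes "finite E" "good E b" "0 < b" "e \<notin> E" "mgen (insert e E) b > 0"
  shows "good (insert e E) b"
  unfolding good_def
proof (intro allI impI)
  fix A assume A: "A \<subseteq> insert e E"
  show "mgen A b > 0"
  proof (cases "e \<in> A")
    case False
    then show ?thesis using A assms(2) by (auto intro: good_pos)
  next
    case True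
    define A0 where "A0 = A - {e}"
    have "A0 \<subseteq> E" using A by (auto simp: A0_def)
    then have A0: "A = insert e A0" "e \<notin> A0" "A0 \<subseteq> E" "finite A0"
      using True finite_subset[of A0 E] assms(1) by (auto simp: A0_def)
    have "A0 \<inter> away E e = away A0 e" using A0 by (auto simp: away_def)
    moreover have p: "mgen A0 b > 0" "mgen (away A0 e) b > 0" "mgen E b > 0"
      using good_pos[OF assms(2)] A0(3) away_subset[of A0 e] by auto
    ultimately have "mgen (away A0 e) b * mgen E b \<le> mgen A0 b * mgen (away E e) b"
      using mgen_ratio[OF assms(1-3), of b A0 "away E e"] A0(3) away_subset[of E e] assms(3)
      by simp
    then have "b * (mgen (away A0 e) b * mgen E b) \<le> b * (mgen A0 b * mgen (away E e) b)"
      using assms(3) by (simp add: mult_left_mono)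
    then have "mgen A0 b * mgen (insert e E) b \<le> mgen A b * mgen E b"
      unfolding A0(1) mgen_insert[OF assms(1,4)] mgen_insert[OF A0(4,2)]
      by (simp add: algebra_simps)
    moreover have "0 < mgen A0 b * mgen (insert e E) b" using p assms(5) by simp
    ultimately show ?thesis using p by (metis less_le_trans zero_less_mult_pos2)
  qed
qed

text \<open>Disjoint edges \<open>S\<close> away from \<open>e\<close> bound the subtracted term by
  \<open>mgen S z\<close>, and strict antimonotonicity makes the loss smaller unless
  \<open>S\<close> exhausts \<open>away E e\<close>.\<close>

lemma mgen_insert_bound:
  assumes "finite E" "good E z" "0 < z" "e \<notin> E" "S \<subseteq> away E e" "pairwise disjnt S"
  shows "mgen (insert e E) z \<ge> mgen E z - z * (1 - z) ^ card S"
    and "S \<noteq> away E e \<Longrightarrow> mgen (insert e E) z > mgen E z - z * (1 - z) ^ card S"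
proof -
  have g: "good (away E e) z" "finite (away E e)"
    using good_subset[OF assms(2) away_subset] finite_away[OF assms(1)] by auto
  have "mgen S z = (1 - z) ^ card S"
    using mgen_matching finite_subset[OF assms(5) g(2)] assms(6) by blast
  then have S: "mgen (insert e E) z - (mgen E z - z * (1 - z) ^ card S)
      = z * (mgen S z - mgen (away E e) z)"
    by (simp add: mgen_insert[OF assms(1,4)] algebra_simps)
  have "0 \<le> z * (mgen S z - mgen (away E e) z)"
    using mgen_antimono[OF g(2,1) assms(3,5)] assms(3) by simp
  then show "mgen (insert e E) z \<ge> mgen E z - z * (1 - z) ^ card S"
    using S by linarith
  show "mgen (insert e E) z > mgen E z - z * (1 - z) ^ card S" if "S \<noteq> away E e"
  proof -
    have "S \<subset> away E e" using that assms(5) by blast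
    from mgen_antimono_strict[OF g(2,1) assms(3) this]
    have "0 < z * (mgen S z - mgen (away E e) z)" using assms(3) by simp
    then show ?thesis using S by linarith
  qed
qed

lemma good_empty [simp]: "good {} z"
  by (simp add: good_def)

text \<open>Edges through \<open>u\<close> meet pairwise, so a matching uses at most one of them;
  inserted one by one, each sees only edges that miss \<open>u\<close>.\<close>

lemma mgen_vertex_expansion:
  assumes "finite E"
  shows "mgen E w = mgen {e \<in> E. u \<notin> e} w -
    w * (\<Sum>e\<in>{e \<in> E. u \<in> e}. mgen (away {e \<in> E. u \<notin> e} e) w)"
proof -
  define A where "A = {e \<in> E. u \<notin> e}"
  have "mgen (A \<union> X) w = mgen A w - w * (\<Sum>e\<in>X. mgen (away A e) w)"
    if "finite X" "\<forall>e\<in>X. u \<in> e" for X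
    using that
  proof (induction X rule: finite_induct)
    case (insert e X)
    have "away (A \<union> X) e = away A e"
      using insert.prems by (auto simp: away_def disjnt_iff)
    moreover have "e \<notin> A \<union> X" using insert by (auto simp: A_def)
    moreover have "finite (A \<union> X)" using assms insert by (simp add: A_def)
    ultimately show ?case
      using insert by (simp add: mgen_insert algebra_simps)
  qed simp
  note * = this[of "{e \<in> E. u \<in> e}"]
  have "mgen E w = mgen (A \<union> {e \<in> E. u \<in> e}) w"
    by (rule arg_cong[where f = "\<lambda>X. mgen X w"]) (auto simp: A_def)
  also have "\<dots> = mgen A w - w * (\<Sum>e\<in>{e \<in> E. u \<in> e}. mgen (away A e) w)"
    by (rule *) (use assms in auto)
  finally show ?thesis unfolding A_def .
qed

section \<open>Glued systems of edges and cycles\<close>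

text \<open>The edge \<open>c\<close> avoids the vertex \<open>r\<close> at which the cycle is attached, \<open>a\<close> and \<open>b\<close> are the neighbours of \<open>c\<close>
  on the cycle, and \<open>R\<close> consists of the remaining edges.\<close>

definition ringlike :: "'a set set \<Rightarrow> bool" where
  "ringlike C \<longleftrightarrow> (\<forall>r. \<exists>c a b R. C = {c, a, b} \<union> R \<and> finite R \<and> c \<noteq> a \<and> c \<noteq> b \<and> a \<noteq> b \<and>
     {c, a, b} \<inter> R = {} \<and> r \<notin> c \<and> (\<forall>e\<in>R. disjnt c e) \<and> (disjnt a b \<longleftrightarrow> R \<noteq> {}))"

text \<open>A new piece may also be disjoint from the previous ones, so the first piece is glued to
  the empty system like any other. The index counts the cycles.\<close>

inductive glued :: "'a set set \<Rightarrow> nat \<Rightarrow> bool" where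
  empty: "glued {} 0"
| edge: "glued E t \<Longrightarrow> e \<notin> E \<Longrightarrow> e \<noteq> {} \<Longrightarrow> e \<inter> \<Union>E \<subseteq> {r} \<Longrightarrow> glued (insert e E) t"
| ring: "glued E t \<Longrightarrow> C \<inter> E = {} \<Longrightarrow> \<Union>C \<inter> \<Union>E \<subseteq> {r} \<Longrightarrow> ringlike C \<Longrightarrow> glued (C \<union> E) (Suc t)"

text \<open>The value of \<open>F\<close> for the extremal cactus at \<open>z\<close> is \<open>(1 - z)\<^sup>t\<close> times this number.\<close>

definition gap :: "real \<Rightarrow> nat \<Rightarrow> nat \<Rightarrow> real" where
  "gap z m t = 1 - (real m - 3 * real t) * z - 2 * real t * z / (1 - z)"

lemma ringlikeE:
  assumes "ringlike C"
  obtains c a b R where "C = {c, a, b} \<union> R" "finite R" "c \<noteq> a" "c \<noteq> b" "a \<noteq> b"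
    "c \<notin> R" "a \<notin> R" "b \<notin> R" "r \<notin> c" "\<forall>e\<in>R. disjnt c e" "disjnt a b \<longleftrightarrow> R \<noteq> {}"
proof -
  from assms[unfolded ringlike_def, THEN spec, of r] obtain c a b R where
    "C = {c, a, b} \<union> R" "finite R" "c \<noteq> a" "c \<noteq> b" "a \<noteq> b" and i: "{c, a, b} \<inter> R = {}" and
    "r \<notin> c" "\<forall>e\<in>R. disjnt c e" "disjnt a b \<longleftrightarrow> R \<noteq> {}"
    by (elim exE conjE)
  moreover from i have "c \<notin> R" "a \<notin> R" "b \<notin> R" by auto
  ultimately show thesis using that by simp
qed

lemma ringlike_finite: "ringlike C \<Longrightarrow> finite C"
  by (erule ringlikeE) simp

lemma ringlike_avoid:
  assumes "ringlike C"
  obtains c where "c \<in> C" "r \<notin> c"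
proof -
  obtain c a b R where C: "C = {c, a, b} \<union> R" "finite R" "c \<noteq> a" "c \<noteq> b" "a \<noteq> b"
    "c \<notin> R" "a \<notin> R" "b \<notin> R" "r \<notin> c" "\<forall>e\<in>R. disjnt c e" "disjnt a b \<longleftrightarrow> R \<noteq> {}"
    by (rule ringlikeE[OF assms, of r])
  show thesis by (rule that[of c]) (use C in simp_all)
qed

lemma ringlike_card:
  assumes "ringlike C"
  shows "3 \<le> card C"
proof -
  obtain c a b R where C: "C = {c, a, b} \<union> R" "finite R" "c \<noteq> a" "c \<noteq> b" "a \<noteq> b"
    "c \<notin> R" "a \<notin> R" "b \<notin> R" "undefined \<notin> c" "\<forall>e\<in>R. disjnt c e" "disjnt a b \<longleftrightarrow> R \<noteq> {}"
    by (rule ringlikeE[OF assms, of undefined])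
  then show ?thesis by simp
qed

lemma glued_finite: "glued E t \<Longrightarrow> finite E"
proof (induction rule: glued.induct)
  case (ring E t C r)
  then show ?case by (simp add: ringlike_finite)
qed auto

lemma glued_card: "glued E t \<Longrightarrow> 3 * t \<le> card E"
proof (induction rule: glued.induct)
  case (edge E t e r)
  then show ?case by (simp add: glued_finite)
next
  case (ring E t C r)
  have "card (C \<union> E) = card C + card E"
    using ring(1,2,4) glued_finite ringlike_finite by (intro card_Un_disjoint) auto
  then show ?case using ring.IH ringlike_card[OF ring(4)] by simp
qed simp

text \<open>Each cycle contributes one edge. If \<open>r\<close> lies on the new cycle and differs
  from the gluing vertex \<open>r0\<close>, the cycle edge avoids \<open>r\<close> and the old
  matching avoids \<open>r0\<close>; otherwise the two roles are exchanged. Either way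
  \<open>r0\<close>, the only possible common vertex, is missed by one side.\<close>

lemma glued_matching_avoiding:
  "glued E t \<Longrightarrow> \<exists>S\<subseteq>E. card S = t \<and> pairwise disjnt S \<and> r \<notin> \<Union>S"
proof (induction arbitrary: r rule: glued.induct)
  case empty
  then show ?case by (auto intro: exI[of _ "{}"])
next
  case (edge E t e r0)
  then show ?case by (meson subset_insertI2)
next
  case (ring E t C r0)
  obtain S c where S: "S \<subseteq> E" "card S = t" "pairwise disjnt S" "r \<notin> \<Union>S" "r0 \<notin> \<Union>S \<or> r0 \<notin> c"
    and c: "c \<in> C" "r \<notin> c"
  proof (cases "r \<in> \<Union>C - {r0}")
    case True
    from ring.IH[of r0] obtain S where S: "S \<subseteq> E" "card S = t" "pairwise disjnt S" "r0 \<notin> \<Union>S"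
      by blast
    from ring(4) obtain c where "c \<in> C" "r \<notin> c" by (rule ringlike_avoid)
    moreover have "r \<notin> \<Union>E" using True ring(3) by blast
    ultimately show ?thesis using S that by blast
  next
    case False
    from ring.IH[of r] obtain S where S: "S \<subseteq> E" "card S = t" "pairwise disjnt S" "r \<notin> \<Union>S"
      by blast
    from ring(4) obtain c where "c \<in> C" "r0 \<notin> c" by (rule ringlike_avoid)
    moreover from this False have "r \<notin> c" by blast
    ultimately show ?thesis using S that by blast
  qed
  have "disjnt c f" if "f \<in> S" for f
    using that S(1,4,5) c ring(3) unfolding disjnt_def by blast
  moreover have "c \<notin> S" using c S ring(2) by blast
  moreover have "finite S" using S glued_finite[OF ring(1)] finite_subset by blast
  ultimately have "card (insert c S) = Suc t" "pairwise disjnt (insert c S)"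
    using S by (auto simp: pairwise_insert disjnt_sym)
  moreover have "insert c S \<subseteq> C \<union> E" "r \<notin> \<Union>(insert c S)" using S c by auto
  ultimately show ?case by blast
qed

lemma glued_edge_bound:
  assumes "glued E t" "good E z" "0 < z" "z < 1" "e \<notin> E" "e \<noteq> {}" "e \<inter> \<Union>E \<subseteq> {r}"
  shows "mgen (insert e E) z \<ge> mgen E z - z * (1 - z) ^ t"
    and "(\<forall>u. t < card {f \<in> insert e E. u \<notin> f}) \<Longrightarrow> mgen (insert e E) z > mgen E z - z * (1 - z) ^ t"
proof -
  note fin = glued_finite[OF assms(1)]
  obtain S where S: "S \<subseteq> E" "card S = t" "pairwise disjnt S" "r \<notin> \<Union>S"
    using glued_matching_avoiding[OF assms(1)] by blast
  have sub: "S \<subseteq> away E e"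
    using S(1,4) assms(7) unfolding away_def disjnt_def by blast
  show "mgen (insert e E) z \<ge> mgen E z - z * (1 - z) ^ t"
    using mgen_insert_bound(1)[OF fin assms(2,3,5) sub S(3)] S(2) by simp
  show "mgen (insert e E) z > mgen E z - z * (1 - z) ^ t" if u: "\<forall>u. t < card {f \<in> insert e E. u \<notin> f}"
  proof -
    have "S \<noteq> away E e"
    proof
      assume S': "S = away E e"
      obtain u where u': "u \<in> e" "e \<inter> \<Union>E \<subseteq> {u}"
        using assms(6,7) by (cases "r \<in> e") auto
      have "disjnt e f" if "f \<in> E" "u \<notin> f" for f
        using that u'(2) unfolding disjnt_def by blast
      then have "{f \<in> insert e E. u \<notin> f} \<subseteq> S"
        using u'(1) unfolding S' away_def by blast
      then have "card {f \<in> insert e E. u \<notin> f} \<le> t"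
        using card_mono[OF finite_subset[OF S(1) fin]] S(2) by blast
      then show False using spec[OF u, of u] by linarith
    qed
    then show ?thesis
      using mgen_insert_bound(2)[OF fin assms(2,3,5) sub S(3)] S(2) by simp
  qed
qed

text \<open>The order of insertion is \<open>c\<close>, \<open>a\<close>, the edges of
  \<open>R\<close>, \<open>b\<close>. Every edge of \<open>R\<close> then finds \<open>c\<close>
  present and disjoint from it, which gives t + 1 disjoint edges away from it, whereas for
  \<open>a\<close> and \<open>b\<close> only \<open>S\<close> is used. The lower bound on
  \<open>g0\<close> keeps all intermediate values positive, so that goodness can be passed
  on.\<close>

lemma glued_ring_bound:
  assumes "glued E t" "good E z" "0 < z" "z < 1" "C \<inter> E = {}" "\<Union>C \<inter> \<Union>E \<subseteq> {r}" "ringlike C"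
    and g0: "mgen E z \<ge> (1 - z) ^ t * g0" "g0 \<ge> (real (card C) - 3) * z + 2 * z / (1 - z)"
  shows "mgen (C \<union> E) z \<ge> (1 - z) ^ Suc t * (g0 - (real (card C) - 3) * z - 2 * z / (1 - z))" (is ?le)
    and "(\<forall>u. Suc t < card {f \<in> C \<union> E. u \<notin> f}) \<Longrightarrow>
      mgen (C \<union> E) z > (1 - z) ^ Suc t * (g0 - (real (card C) - 3) * z - 2 * z / (1 - z))"
      (is "?nc \<Longrightarrow> ?lt")
    and "mgen (C \<union> E) z > 0 \<Longrightarrow> good (C \<union> E) z" (is "?pos \<Longrightarrow> ?good")
proof -
  note fin = glued_finite[OF assms(1)]
  obtain c a b R where C: "C = {c, a, b} \<union> R" "finite R" "c \<noteq> a" "c \<noteq> b" "a \<noteq> b"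
    "c \<notin> R" "a \<notin> R" "b \<notin> R" and c: "r \<notin> c" "\<forall>e\<in>R. disjnt c e" and ab: "disjnt a b \<longleftrightarrow> R \<noteq> {}"
    by (rule ringlikeE[OF assms(7), of r])
  have card_C: "real (card C) - 3 = real (card R)"
    using C by simp
  define y where "y = (1 - z) ^ t"
  have y: "y > 0" using assms(4) by (simp add: y_def)
  obtain S where S: "S \<subseteq> E" "card S = t" "pairwise disjnt S" "r \<notin> \<Union>S"
    using glued_matching_avoiding[OF assms(1)] by blast
  have finS: "finite S" using S(1) fin finite_subset by blast
  have outer: "disjnt e f" if "e \<in> C" "f \<in> E" "r \<notin> e \<or> r \<notin> f" for e f
    using that assms(6) unfolding disjnt_def by blast
  have SC: "disjnt e f" if "e \<in> C" "f \<in> S" for e f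
    using outer[OF that(1)] that(2) S by blast
  have C_notin: "e \<notin> E" if "e \<in> C" for e using that assms(5) by blast
  have q: "z / (1 - z) > 0" "g0 * (1 - z) > 0" "g0 > real (card R) * z + z / (1 - z)" "g0 > 0"
  proof -
    show 1: "z / (1 - z) > 0" using assms(3,4) by simp
    have "0 \<le> real (card R) * z" using assms(3) by simp
    moreover have "2 * z / (1 - z) = z / (1 - z) + z / (1 - z)" by (simp add: add_divide_distrib[symmetric])
    ultimately show "g0 > real (card R) * z + z / (1 - z)"
      using g0(2) 1 unfolding card_C by linarith
    then show "g0 > 0" using 1 \<open>0 \<le> real (card R) * z\<close> by linarith
    then show "g0 * (1 - z) > 0" using assms(4) by simp
  qed
  have zz: "(1 - z) * y * (g0 - z / (1 - z)) = (1 - z) * y * g0 - z * y"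
    using assms(4) by (simp add: field_simps)

  have aw: "away E c = E" using outer[of c] C(1) c(1) by (auto simp: away_def)
  define E1 where "E1 = insert c E"
  have m1: "mgen E1 z = (1 - z) * mgen E z"
    unfolding E1_def using fin C_notin[of c] C(1) aw by (simp add: mgen_insert algebra_simps)
  have E0pos: "mgen E z > 0" using g0(1) mult_pos_pos[OF y q(4)] unfolding y_def by linarith
  have good1: "good E1 z"
    unfolding E1_def
    using good_insert[OF fin assms(2,3) C_notin[of c]] m1 E0pos assms(4) C(1)
    by (simp add: E1_def)
  have fin1: "finite E1" using fin by (simp add: E1_def)
  have m1': "mgen E1 z \<ge> (1 - z) * y * g0"
    using g0(1) assms(4) unfolding m1 y_def by (simp add: mult.assoc)

  have sub1: "S \<subseteq> away E1 a" using SC[of a] S C(1) by (auto simp: away_def E1_def)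
  have a1: "a \<notin> E1" using C C_notin[of a] by (auto simp: E1_def)
  note ins2 = mgen_insert_bound[OF fin1 good1 assms(3) a1 sub1 S(3), unfolded S(2), folded y_def]
  define E2 where "E2 = insert a E1"
  have m2: "mgen E2 z \<ge> (1 - z) * y * (g0 - z / (1 - z))"
    using ins2(1) m1' zz unfolding E2_def by linarith
  have m2s: "mgen E2 z > (1 - z) * y * (g0 - z / (1 - z))" if "S \<noteq> away E1 a"
    using ins2(2)[OF that] m1' zz unfolding E2_def by linarith
  have fin2: "finite E2" using fin1 by (simp add: E2_def)
  have "mgen E2 z > 0"
  proof -
    have "0 \<le> real (card R) * z" using assms(3) by simp
    then have "g0 - z / (1 - z) > 0" using q(3) by linarith
    then have "(1 - z) * y * (g0 - z / (1 - z)) > 0" using y assms(4) by simp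
    then show ?thesis using m2 by linarith
  qed
  then have good2: "good E2 z" using good_insert[OF fin1 good1 assms(3) a1] by (simp add: E2_def)

  \<comment> \<open>The edges of \<open>R\<close> enter one at a time because each insertion needs
    goodness of the stage before it.\<close>
  have 3: "good (R' \<union> E2) z \<and> mgen (R' \<union> E2) z \<ge> mgen E2 z - real (card R') * (1 - z) * y * z"
    if "R' \<subseteq> R" for R'
    using finite_subset[OF that C(2)] that
  proof (induction R' rule: finite_induct)
    case empty
    then show ?case using good2 by simp
  next
    case (insert e R')
    define E3 where "E3 = R' \<union> E2"
    have IH: "good E3 z" "mgen E3 z \<ge> mgen E2 z - real (card R') * (1 - z) * y * z"
      using insert by (auto simp: E3_def)
    have e: "e \<in> R" "e \<notin> E3" "finite E3" "e \<in> C"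
      using insert C C_notin[of e] fin2 by (auto simp: E3_def E2_def E1_def)
    have sub: "insert c S \<subseteq> away E3 e"
      using SC[OF e(4)] S bspec[OF c(2) e(1)] by (auto simp: away_def E3_def E2_def E1_def disjnt_sym)
    have pw: "pairwise disjnt (insert c S)"
      using SC[of c] C(1) S(3) by (auto simp: pairwise_insert disjnt_sym)
    have cd: "card (insert c S) = Suc t"
      using S C_notin[of c] C(1) finS by (subst card_insert_disjoint) auto
    have step: "mgen (insert e E3) z \<ge> mgen E3 z - z * (1 - z) ^ Suc t"
      using mgen_insert_bound(1)[OF e(3) IH(1) assms(3) e(2) sub pw] unfolding cd by simp
    have le: "mgen (insert e E3) z \<ge> mgen E2 z - real (card (insert e R')) * (1 - z) * y * z"
      using step IH(2) insert.hyps by (simp add: y_def algebra_simps)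
    have "real (card (insert e R')) \<le> real (card R)"
      using insert.prems C(2) by (simp add: card_mono del: card_insert_disjoint)
    then have "real (card (insert e R')) * z \<le> real (card R) * z"
      using assms(3) by simp
    then have "g0 - z / (1 - z) - real (card (insert e R')) * z > 0" using q(3) by linarith
    then have "(1 - z) * y * (g0 - z / (1 - z) - real (card (insert e R')) * z) > 0"
      using y assms(4) by simp
    then have "mgen (insert e E3) z > 0"
      using le m2 by (simp add: algebra_simps)
    then have "good (insert e E3) z"
      using good_insert[OF e(3) IH(1) assms(3) e(2)] by simp
    then show ?case using le by (simp add: E3_def)
  qed
  define E3 where "E3 = R \<union> E2"
  have good3: "good E3 z" and m3: "mgen E3 z \<ge> mgen E2 z - real (card R) * (1 - z) * y * z"
    using 3[of R] by (auto simp: E3_def)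
  have fin3: "finite E3" using fin2 C(2) by (simp add: E3_def)
  have b3: "b \<notin> E3" using C C_notin[of b] by (auto simp: E3_def E2_def E1_def)
  have CE: "C \<union> E = insert b E3" using C(1) by (auto simp: E3_def E2_def E1_def)
  show "?good" if ?pos using that good_insert[OF fin3 good3 assms(3) b3] CE by simp
  have target: "(1 - z) ^ Suc t * (g0 - (real (card C) - 3) * z - 2 * z / (1 - z))
      = (1 - z) * y * (g0 - z / (1 - z)) - real (card R) * (1 - z) * y * z - z * y"
    unfolding card_C y_def using assms(4) by (simp add: field_simps)
  have sub3: "S \<subseteq> away E3 b" using SC[of b] S C(1) by (auto simp: away_def E3_def E2_def E1_def)
  note ins3 = mgen_insert_bound[OF fin3 good3 assms(3) b3 sub3 S(3), unfolded S(2), folded y_def]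
  show le: ?le unfolding target CE using ins3(1) m2 m3 by linarith
  show ?lt if nc: ?nc
  proof (cases "S = away E1 a \<and> S = away E3 b")
    case False
    then show ?thesis unfolding target CE using ins3 m2 m2s m3 by fastforce
  next
    case True
    \<comment> \<open>In a cycle longer than a triangle, \<open>a\<close> is present and disjoint
      from \<open>b\<close> when \<open>b\<close> is inserted, so \<open>S\<close> could not be
      everything away from \<open>b\<close>.\<close>
    have "R = {}"
    proof (rule ccontr)
      assume "R \<noteq> {}"
      then have "a \<in> away E3 b" using ab by (auto simp: away_def E3_def E2_def disjnt_sym)
      then show False using True S C_notin[of a] C(1) by blast
    qed
    then have E3: "E3 = {c, a} \<union> E" and C': "C = {c, a, b}" using C(1) by (auto simp: E3_def E2_def E1_def)
    have aE: "away E a \<subseteq> S" "away E b \<subseteq> S" using True by (auto simp: away_def E1_def E3)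
    have cE: "card (away E a) \<le> t" "card (away E b) \<le> t"
      using card_mono[OF finS aE(1)] card_mono[OF finS aE(2)] S(2) by auto
    \<comment> \<open>If \<open>a\<close> and \<open>b\<close> both contain \<open>r\<close>, then
      \<open>r\<close> is the centre. If one of them misses \<open>r\<close>, it is disjoint from
      \<open>E\<close>, so \<open>E\<close> has at most \<open>t\<close> edges; having at least
      \<open>3 * t\<close>, it is empty, and any common vertex of \<open>a\<close> and
      \<open>b\<close> serves.\<close>
    obtain u where u: "u \<in> a" "u \<in> b" "card {f \<in> E. u \<notin> f} \<le> t"
    proof (cases "r \<in> a \<and> r \<in> b")
      case True
      have "{f \<in> E. r \<notin> f} \<subseteq> away E a"
        using outer[of a] C(1) by (auto simp: away_def)
      then have "card {f \<in> E. r \<notin> f} \<le> t"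
        using card_mono[OF finite_away[OF fin]] cE(1) le_trans by blast
      then show ?thesis using that True by blast
    next
      case False
      then have "away E a = E \<or> away E b = E"
        using outer[of a] outer[of b] C(1) by (auto simp: away_def)
      then have "card E \<le> t" using cE by auto
      then have "card E = 0" using glued_card[OF assms(1)] by linarith
      then have "E = {}" using fin by simp
      moreover obtain u where "u \<in> a" "u \<in> b" using ab \<open>R = {}\<close> by (auto simp: disjnt_iff)
      ultimately show ?thesis using that by simp
    qed
    have "{f \<in> C \<union> E. u \<notin> f} \<subseteq> insert c {f \<in> E. u \<notin> f}" using u C' by auto
    then have "card {f \<in> C \<union> E. u \<notin> f} \<le> card (insert c {f \<in> E. u \<notin> f})"
      using fin by (intro card_mono) auto
    also have "\<dots> \<le> Suc t" using u(3) fin by (simp add: card_insert_if)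
    finally show ?thesis using spec[OF nc, of u] by linarith
  qed
qed

lemma gap_edge: "gap z (Suc m) t = gap z m t - z"
  by (simp add: gap_def algebra_simps)

lemma gap_ring: "gap z (n + m) (Suc t) = gap z m t - (real n - 3) * z - 2 * z / (1 - z)"
  by (simp add: gap_def algebra_simps add_divide_distrib)

text \<open>The three claims are proved together because each gluing step needs goodness of the
  previous stage. Every piece lowers \<open>gap\<close> strictly, so a nonnegative final value makes
  all earlier ones positive. Goodness of the final stage is conditional, which admits the case that
  \<open>gap\<close> ends at 0.\<close>

theorem glued_bound:
  assumes "glued E t" "0 < z" "z < 1" "gap z (card E) t \<ge> 0"
  shows "mgen E z \<ge> (1 - z) ^ t * gap z (card E) t
    \<and> ((\<forall>u. t < card {f \<in> E. u \<notin> f}) \<longrightarrow> mgen E z > (1 - z) ^ t * gap z (card E) t)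
    \<and> (mgen E z > 0 \<longrightarrow> good E z)"
  using assms(1,4)
proof (induction rule: glued.induct)
  case empty
  then show ?case by (simp add: gap_def)
next
  case (edge E t e r)
  have cd: "card (insert e E) = Suc (card E)" using edge(1,2) by (simp add: glued_finite)
  have g: "gap z (card E) t > 0" using edge.prems assms(2) unfolding cd gap_edge by simp
  have pos: "(1 - z) ^ t > 0" using assms(3) by simp
  have le: "mgen E z \<ge> (1 - z) ^ t * gap z (card E) t" using edge.IH g by simp
  have "mgen E z > 0" using le mult_pos_pos[OF pos g] by linarith
  then have gd: "good E z" using edge.IH g by simp
  note bounds = glued_edge_bound[OF edge(1) gd assms(2,3) edge(2-4)]
  have "(1 - z) ^ t * gap z (card (insert e E)) t = (1 - z) ^ t * gap z (card E) t - z * (1 - z) ^ t"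
    unfolding cd gap_edge by (simp add: algebra_simps)
  then show ?case
    using bounds le good_insert[OF glued_finite[OF edge(1)] gd assms(2) edge(2)]
    by (intro conjI impI) (linarith, force, blast)
next
  case (ring E t C r)
  have cd: "card (C \<union> E) = card C + card E"
    using glued_finite[OF ring(1)] ring(2) ringlike_finite[OF ring(4)] by (simp add: card_Un_disjoint)
  have n: "(real (card C) - 3) * z \<ge> 0" using ringlike_card[OF ring(4)] assms(2) by simp
  have g0: "gap z (card E) t \<ge> (real (card C) - 3) * z + 2 * z / (1 - z)"
    using ring.prems unfolding cd gap_ring by simp
  moreover have "2 * z / (1 - z) > 0" using assms(2,3) by simp
  ultimately have g: "gap z (card E) t > 0" using n by linarith
  have pos: "(1 - z) ^ t > 0" using assms(3) by simp
  have le: "mgen E z \<ge> (1 - z) ^ t * gap z (card E) t" using ring.IH g by simp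
  have "mgen E z > 0" using le mult_pos_pos[OF pos g] by linarith
  then have gd: "good E z" using ring.IH g by simp
  note bounds = glued_ring_bound[OF ring(1) gd assms(2,3) ring(2-4) le g0]
  show ?case
    unfolding cd gap_ring using bounds(1) bounds(2) bounds(3) by simp
qed

section \<open>Paths and cycles\<close>

definition adj :: "'a set set \<Rightarrow> ('a \<times> 'a) set" where
  "adj E = {(x, y). \<exists>e\<in>E. x \<in> e \<and> y \<in> e}"

definition conn :: "'a set set \<Rightarrow> bool" where
  "conn E \<longleftrightarrow> (\<forall>x\<in>\<Union>E. \<forall>y\<in>\<Union>E. (x, y) \<in> (adj E)\<^sup>*)"

text \<open>Sequences are functions with arbitrary values beyond the range, so that rotation and
  concatenation become index arithmetic.\<close>

definition fpath :: "'a set set \<Rightarrow> nat \<Rightarrow> (nat \<Rightarrow> 'a) \<Rightarrow> (nat \<Rightarrow> 'a set) \<Rightarrow> bool" where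
  "fpath E n v e \<longleftrightarrow> inj_on v {..n} \<and> inj_on e {..<n} \<and>
     (\<forall>i<n. e i \<in> E \<and> v i \<in> e i \<and> v (Suc i) \<in> e i)"

definition fcycle :: "'a set set \<Rightarrow> nat \<Rightarrow> (nat \<Rightarrow> 'a) \<Rightarrow> (nat \<Rightarrow> 'a set) \<Rightarrow> bool" where
  "fcycle E n v e \<longleftrightarrow> 2 \<le> n \<and> v n = v 0 \<and> inj_on v {..<n} \<and> inj_on e {..<n} \<and>
     (\<forall>i<n. e i \<in> E \<and> v i \<in> e i \<and> v (Suc i) \<in> e i)"

text \<open>A cycle taken as a subgraph is determined by its edge set.\<close>

definition cyc :: "'a set set \<Rightarrow> 'a set set set" where
  "cyc E = {e ` {..<n} | n v e. fcycle E n v e}"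

lemma adj_mono: "A \<subseteq> B \<Longrightarrow> adj A \<subseteq> adj B"
  by (auto simp: adj_def)

lemma adj_sym: "(x, y) \<in> (adj E)\<^sup>* \<Longrightarrow> (y, x) \<in> (adj E)\<^sup>*"
  by (rule symD[OF sym_rtrancl]) (auto simp: sym_def adj_def)

lemma connD: "conn E \<Longrightarrow> x \<in> \<Union>E \<Longrightarrow> y \<in> \<Union>E \<Longrightarrow> (x, y) \<in> (adj E)\<^sup>*"
  unfolding conn_def by blast

lemma conn_single [simp]: "conn {e}"
  by (auto simp: conn_def adj_def intro!: r_into_rtrancl)

lemma conn_Un:
  assumes "conn A" "conn B" "x \<in> \<Union>A" "x \<in> \<Union>B"
  shows "conn (A \<union> B)"
proof -
  have "(y, x) \<in> (adj (A \<union> B))\<^sup>*" if "y \<in> \<Union>(A \<union> B)" for y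
  proof (cases "y \<in> \<Union>A")
    case True
    then show ?thesis
      using connD[OF assms(1) True assms(3)] rtrancl_mono[OF adj_mono[of A "A \<union> B"]] by blast
  next
    case False
    then have "y \<in> \<Union>B" using that by blast
    then show ?thesis
      using connD[OF assms(2) _ assms(4)] rtrancl_mono[OF adj_mono[of B "A \<union> B"]] by blast
  qed
  then show ?thesis
    unfolding conn_def by (meson adj_sym rtrancl_trans)
qed

text \<open>The minimum is taken over all walks with ends in \<open>Z\<close>, not for one fixed
  pair; hence no proper segment has its ends in \<open>Z\<close>. A repeated vertex or edge would
  give a shorter walk.\<close>

lemma shortest_path:
  assumes "(x, y) \<in> (adj E)\<^sup>*" "(x, y) \<in> Z"
  obtains n v e where "fpath E n v e" "(v 0, v n) \<in> Z"
    "\<And>i j. i \<le> j \<Longrightarrow> j \<le> n \<Longrightarrow> (v i, v j) \<in> Z \<Longrightarrow> i = 0 \<and> j = n"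
proof -
  define P where "P n \<longleftrightarrow> (\<exists>x y. (x, y) \<in> Z \<and> (x, y) \<in> adj E ^^ n)" for n
  define n where "n = (LEAST n. P n)"
  have "\<exists>n. P n" using assms by (auto simp: P_def rtrancl_power)
  then have "P n" unfolding n_def by (rule LeastI_ex)
  have least: "n \<le> m" if "P m" for m using that unfolding n_def by (rule Least_le)
  from \<open>P n\<close> obtain v where v: "(v 0, v n) \<in> Z" "\<And>i. i < n \<Longrightarrow> (v i, v (Suc i)) \<in> adj E"
    unfolding P_def relpow_fun_conv by blast
  from v(2) have "\<forall>i. \<exists>e. i < n \<longrightarrow> e \<in> E \<and> v i \<in> e \<and> v (Suc i) \<in> e"
    by (fastforce simp: adj_def)
  then obtain e where e: "\<And>i. i < n \<Longrightarrow> e i \<in> E \<and> v i \<in> e i \<and> v (Suc i) \<in> e i"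
    by metis
  have seg: "(v i, v j) \<in> adj E ^^ (j - i)" if "i \<le> j" "j \<le> n" for i j
    unfolding relpow_fun_conv using that v(2)
    by (intro exI[of _ "\<lambda>m. v (i + m)"]) auto
  \<comment> \<open>Replacing the segment from \<open>i\<close> to \<open>j\<close> by a walk of
    length \<open>d\<close> cannot make the whole shorter than \<open>n\<close>.\<close>
  have seg': "n \<le> i + d + (n - j)" if "i \<le> j" "j \<le> n" "(v i, v j) \<in> adj E ^^ d" for i j d
  proof (rule least)
    have "(v 0, v j) \<in> adj E ^^ (i + d)"
      using seg[of 0 i] that relpow_add by fastforce
    then have "(v 0, v n) \<in> adj E ^^ (i + d + (n - j))"
      using seg[of j n] that relpow_add by fastforce
    then show "P (i + d + (n - j))" unfolding P_def using v(1) by blast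
  qed
  have "inj_on v {..n}"
  proof (rule linorder_inj_onI')
    fix i j assume "i \<in> {..n}" "j \<in> {..n}" "i < j"
    then show "v i \<noteq> v j" using seg'[of i j 0] by auto
  qed
  moreover have "inj_on e {..<n}"
  proof (rule linorder_inj_onI')
    fix i j assume ij: "i \<in> {..<n}" "j \<in> {..<n}" "i < j"
    show "e i \<noteq> e j"
    proof
      assume "e i = e j"
      \<comment> \<open>A repeated edge contains \<open>v i\<close> and \<open>v (Suc j)\<close> and
        so bridges at least two steps by one.\<close>
      then have "(v i, v (Suc j)) \<in> adj E ^^ 1" using e[of i] e[of j] ij by (auto simp: adj_def)
      then show False using seg'[of i "Suc j" 1] ij by auto
    qed
  qed
  ultimately have "fpath E n v e" using e by (auto simp: fpath_def)
  moreover have "i = 0 \<and> j = n" if "i \<le> j" "j \<le> n" "(v i, v j) \<in> Z" for i j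
  proof -
    have "P (j - i)" unfolding P_def using seg[OF that(1,2)] that(3) by blast
    then show ?thesis using least[of "j - i"] that by auto
  qed
  ultimately show thesis using v(1) that by blast
qed

lemma cycI: "fcycle E n v e \<Longrightarrow> e ` {..<n} \<in> cyc E"
  unfolding cyc_def by blast

lemma cycE:
  assumes "C \<in> cyc E"
  obtains n v e where "fcycle E n v e" "C = e ` {..<n}"
  using assms unfolding cyc_def by blast

lemma cyc_subset: "C \<in> cyc E \<Longrightarrow> C \<subseteq> E"
  by (auto simp: cyc_def fcycle_def)

lemma fcycle_subset: "fcycle E n v e \<Longrightarrow> e ` {..<n} \<subseteq> F \<Longrightarrow> fcycle F n v e"
  by (auto simp: fcycle_def)

lemma cyc_restrict: "C \<in> cyc E \<Longrightarrow> C \<subseteq> F \<Longrightarrow> C \<in> cyc F"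
  by (erule cycE) (metis cycI fcycle_subset)

lemma cyc_mono: "A \<subseteq> B \<Longrightarrow> cyc A \<subseteq> cyc B"
  using cyc_restrict cyc_subset by blast

lemma cyc_card: "C \<in> cyc E \<Longrightarrow> 2 \<le> card C"
  by (erule cycE) (simp add: fcycle_def card_image)

text \<open>Moves any chosen edge or vertex of a cycle to index 0; the wrap-around rests on
  \<open>v n = v 0\<close>.\<close>

lemma fcycle_shift:
  assumes "fcycle E n v e"
  shows "fcycle E n (\<lambda>i. v ((i + p) mod n)) (\<lambda>i. e ((i + p) mod n))"
    and "(\<lambda>i. e ((i + p) mod n)) ` {..<n} = e ` {..<n}"
proof -
  have n: "n > 0" using assms by (simp add: fcycle_def)
  have inj: "inj_on (\<lambda>i. (i + p) mod n) {..<n}"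
  proof (rule linorder_inj_onI')
    fix x y assume xy: "x \<in> {..<n}" "y \<in> {..<n}" "x < y"
    show "(x + p) mod n \<noteq> (y + p) mod n"
    proof
      assume "(x + p) mod n = (y + p) mod n"
      then have "n dvd y + p - (x + p)"
        using xy by (subst mod_eq_dvd_iff_nat[symmetric]) auto
      then show False using xy by (auto dest: dvd_imp_le)
    qed
  qed
  have img: "(\<lambda>i. (i + p) mod n) ` {..<n} = {..<n}"
    using n by (intro endo_inj_surj inj) auto
  have e: "e i \<in> E \<and> v i \<in> e i \<and> v (Suc i mod n) \<in> e i" if "i < n" for i
  proof (cases "Suc i = n")
    case True
    then show ?thesis using assms that by (force simp: fcycle_def)
  next
    case False
    then show ?thesis using assms that by (force simp: fcycle_def)
  qed
  show "(\<lambda>i. e ((i + p) mod n)) ` {..<n} = e ` {..<n}"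
    using img by (metis image_image)
  note inj' = comp_inj_on[OF inj, unfolded img comp_def]
  have "inj_on v {..<n}" "inj_on e {..<n}" using assms by (auto simp: fcycle_def)
  then show "fcycle E n (\<lambda>i. v ((i + p) mod n)) (\<lambda>i. e ((i + p) mod n))"
    using assms n e[of "(_ + p) mod n"] unfolding fcycle_def
    by (auto simp: mod_Suc_eq intro: inj')
qed

text \<open>A shortest path in \<open>A\<close> between two distinct vertices of \<open>B\<close> has no inner vertex in \<open>B\<close>, so any
  path in \<open>B\<close> between its ends closes it to a cycle.\<close>

lemma crossing_cycle:
  assumes "conn A" "conn B" "A \<inter> B = {}"
    and "x \<in> \<Union>A" "x \<in> \<Union>B" "y \<in> \<Union>A" "y \<in> \<Union>B" "x \<noteq> y"
  obtains D where "D \<in> cyc (A \<union> B)" "D \<inter> A \<noteq> {}" "D \<inter> B \<noteq> {}"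
proof -
  define Z where "Z = {(x, y). x \<in> \<Union>B \<and> y \<in> \<Union>B \<and> x \<noteq> y}"
  obtain p v e where P: "fpath A p v e" "(v 0, v p) \<in> Z"
    "\<And>i j. i \<le> j \<Longrightarrow> j \<le> p \<Longrightarrow> (v i, v j) \<in> Z \<Longrightarrow> i = 0 \<and> j = p"
    by (rule shortest_path[OF connD[OF assms(1,4,6)], of Z]) (use assms in \<open>auto simp: Z_def\<close>)
  have p: "p > 0" using P(2) by (cases p) (auto simp: Z_def)
  have off: "v i \<notin> \<Union>B" if "0 < i" "i < p" for i
  proof
    assume "v i \<in> \<Union>B"
    then have "(v 0, v i) \<in> Z \<or> v i = v 0" using P(2) by (auto simp: Z_def)
    then have "v i = v 0" using P(3)[of 0 i] that by auto
    then show False using P(1) that unfolding fpath_def by (auto dest: inj_onD[of _ _ i 0])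
  qed
  have "(v p, v 0) \<in> (adj B)\<^sup>*"
    using P(2) by (intro connD[OF assms(2)]) (auto simp: Z_def)
  then obtain q w f where Q: "fpath B q w f" "w 0 = v p" "w q = v 0"
    by (rule shortest_path[where Z = "{(v p, v 0)}"]) auto
  have q: "q > 0" using P(2) Q by (cases q) (auto simp: Z_def)
  define n where "n = p + q"
  define u where "u i = (if i \<le> p then v i else w (i - p))" for i
  define g where "g i = (if i < p then e i else f (i - p))" for i
  have wB: "w i \<in> \<Union>B" if "i \<le> q" for i
    using Q(1) that q unfolding fpath_def by (cases i) (auto simp: Suc_le_eq)
  \<comment> \<open>A common vertex lies in \<open>B\<close>, hence is an end of the path in
    \<open>A\<close>; these ends are also the ends of the simple path \<open>w\<close>.\<close>
  have vw: "v i \<noteq> w j" if "i \<le> p" "0 < j" "j < q" for i j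
  proof
    assume eq: "v i = w j"
    then have "i = 0 \<or> i = p" using off[of i] wB[of j] that by fastforce
    then have "w j = w q \<or> w j = w 0" using eq Q by auto
    then show False using Q(1) that unfolding fpath_def
      by (auto dest: inj_onD[of _ _ j q] inj_onD[of _ _ j 0])
  qed
  have "inj_on u {..<n}"
  proof (rule linorder_inj_onI')
    fix i j assume ij: "i \<in> {..<n}" "j \<in> {..<n}" "i < j"
    consider "j \<le> p" | "i \<le> p" "p < j" | "p < i" by linarith
    then show "u i \<noteq> u j"
    proof cases
      case 1
      then show ?thesis using P(1) ij unfolding fpath_def u_def by (auto dest: inj_onD)
    next
      case 2
      then show ?thesis using vw[of i "j - p"] ij by (auto simp: u_def n_def)
    next
      case 3
      then show ?thesis
        using Q(1) ij unfolding fpath_def u_def n_def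
        by (auto dest: inj_onD[of w "{..q}" "i - p" "j - p"])
    qed
  qed
  moreover have "inj_on g {..<n}"
  proof (rule linorder_inj_onI')
    fix i j assume ij: "i \<in> {..<n}" "j \<in> {..<n}" "i < j"
    consider "j < p" | "i < p" "p \<le> j" | "p \<le> i" by linarith
    then show "g i \<noteq> g j"
    proof cases
      case 1
      then show ?thesis using P(1) ij unfolding fpath_def g_def by (auto dest: inj_onD)
    next
      case 2
      then have "e i \<in> A" "f (j - p) \<in> B" using P(1) Q(1) ij by (auto simp: fpath_def n_def)
      then show ?thesis using 2 assms(3) by (auto simp: g_def)
    next
      case 3
      then show ?thesis
        using Q(1) ij unfolding fpath_def g_def n_def
        by (auto dest: inj_onD[of f "{..<q}" "i - p" "j - p"])
    qed
  qed
  moreover have "g i \<in> A \<union> B \<and> u i \<in> g i \<and> u (Suc i) \<in> g i" if "i < n" for i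
  proof (cases "i < p")
    case True
    then show ?thesis using P(1) by (auto simp: fpath_def g_def u_def)
  next
    case False
    then have "u i = w (i - p)" "u (Suc i) = w (Suc (i - p))"
      using Q(2) by (auto simp: u_def Suc_diff_le)
    then show ?thesis using Q(1) False that by (auto simp: fpath_def g_def n_def)
  qed
  moreover have "u n = u 0" using q Q(3) by (simp add: u_def n_def)
  ultimately have "fcycle (A \<union> B) n u g" using p q by (auto simp: fcycle_def n_def)
  then have "g ` {..<n} \<in> cyc (A \<union> B)" by (rule cycI)
  moreover have "g 0 \<in> A" "g p \<in> B" using P(1) Q(1) p q by (auto simp: g_def fpath_def)
  moreover have "0 \<in> {..<n}" "p \<in> {..<n}" using p q by (auto simp: n_def)
  ultimately show thesis using that by blast
qed

section \<open>The structure of linear cacti\<close>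

lemma fcycle_inj:
  assumes "fcycle E n v e" "i < n" "j < n"
  shows "e i = e j \<longleftrightarrow> i = j" "v i = v j \<longleftrightarrow> i = j"
  using assms unfolding fcycle_def
  using inj_on_eq_iff[of e "{..<n}" i j] inj_on_eq_iff[of v "{..<n}" i j] by simp_all

lemma fcycleD:
  assumes "fcycle E n v e"
  shows "v n = v 0" "2 \<le> n" "\<And>i. i < n \<Longrightarrow> e i \<in> E" "\<And>i. i < n \<Longrightarrow> v i \<in> e i"
    "\<And>i. i < n \<Longrightarrow> v (Suc i) \<in> e i"
  using assms unfolding fcycle_def by blast+

locale linear_system =
  fixes E :: "'a set set"
  assumes fin: "finite E"
    and edge_card: "e \<in> E \<Longrightarrow> 2 \<le> card e"
    and linear: "e \<in> E \<Longrightarrow> f \<in> E \<Longrightarrow> e \<noteq> f \<Longrightarrow> card (e \<inter> f) \<le> 1"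
begin

lemma edge_finite: "e \<in> E \<Longrightarrow> finite e"
  using edge_card card.infinite by fastforce

lemma edge_two:
  assumes "e \<in> E"
  obtains x y where "x \<in> e" "y \<in> e" "x \<noteq> y"
proof -
  have "\<not> card e \<le> 1" using edge_card[OF assms] by simp
  then show thesis using that edge_finite[OF assms] by (auto simp: card_le_Suc0_iff_eq)
qed

lemma edge_nonempty: "e \<in> E \<Longrightarrow> e \<noteq> {}"
  using edge_card by fastforce

lemma linear_eq:
  assumes "e \<in> E" "f \<in> E" "x \<in> e" "x \<in> f" "y \<in> e" "y \<in> f" "x \<noteq> y"
  shows "e = f"
proof (rule ccontr)
  assume "e \<noteq> f"
  from linear[OF assms(1,2) this] show False
    using assms edge_finite[OF assms(1)] by (auto simp: card_le_Suc0_iff_eq)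
qed

text \<open>The edges of a cycle of length 2 would share the distinct vertices \<open>v 0\<close>
  and \<open>v 1\<close>.\<close>

lemma fcycle_length:
  assumes "fcycle E n v e"
  shows "3 \<le> n"
proof (rule ccontr)
  assume "\<not> 3 \<le> n"
  then have n: "n = 2" using assms by (simp add: fcycle_def)
  note D = fcycleD[OF assms, unfolded n]
  have "v 0 \<noteq> v 1" "e 0 \<noteq> e 1" using fcycle_inj[OF assms, of 0 1] n by simp_all
  then show False
    using linear_eq[of "e 0" "e 1" "v 0" "v 1"] D(1) D(3-5)[of 0] D(3-5)[of 1]
    by (simp add: numeral_2_eq_2)
qed

end

locale linear_cactus = linear_system +
  assumes separated: "C \<in> cyc E \<Longrightarrow> D \<in> cyc E \<Longrightarrow> C \<noteq> D \<Longrightarrow> card (\<Union>C \<inter> \<Union>D) \<le> 1"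
begin

lemma separated_eq:
  assumes "C \<in> cyc E" "D \<in> cyc E" "x \<in> \<Union>C" "x \<in> \<Union>D" "y \<in> \<Union>C" "y \<in> \<Union>D" "x \<noteq> y"
  shows "C = D"
proof (rule ccontr)
  assume "C \<noteq> D"
  have "finite (\<Union>C)"
    using cyc_subset[OF assms(1)] edge_finite fin by (meson finite_Union finite_subset subsetD)
  then have "finite (\<Union>C \<inter> \<Union>D)" by simp
  then show False
    using separated[OF assms(1,2) \<open>C \<noteq> D\<close>] assms unfolding One_nat_def card_le_Suc0_iff_eq[OF \<open>finite (\<Union>C \<inter> \<Union>D)\<close>]
    by blast
qed

text \<open>An edge has two vertices, so cycles with a common edge share two vertices.\<close>

lemma cyc_eq:
  assumes "C \<in> cyc E" "D \<in> cyc E" "e \<in> C" "e \<in> D"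
  shows "C = D"
proof -
  have "e \<in> E" using cyc_subset[OF assms(1)] assms(3) by blast
  then obtain x y where "x \<in> e" "y \<in> e" "x \<noteq> y" by (rule edge_two)
  then show ?thesis using separated_eq[OF assms(1,2), of x y] assms(3,4) by blast
qed

text \<open>If \<open>e 0\<close> met \<open>e i\<close> at \<open>w\<close>, it would close an arc
  to a cycle through \<open>e 0\<close>, which must be the whole cycle although it omits an edge.
  For \<open>w\<close> different from \<open>v 1\<close> the arc is \<open>e 1, ..., e i\<close> and
  \<open>e (n - 1)\<close> is omitted; for \<open>w = v 1\<close> it is
  \<open>e i, ..., e (n - 1)\<close> and \<open>e 1\<close> is omitted.\<close>

lemma chordless:
  assumes cy: "fcycle E n v e" and i: "2 \<le> i" "i + 2 \<le> n"
  shows "disjnt (e 0) (e i)"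
proof (rule ccontr)
  assume "\<not> disjnt (e 0) (e i)"
  then obtain w where w: "w \<in> e 0" "w \<in> e i" by (auto simp: disjnt_iff)
  have e: "e j \<in> E" "v j \<in> e j" "v (Suc j) \<in> e j" if "j < n" for j
    using cy that by (auto simp: fcycle_def)
  have inj: "e j = e l \<longleftrightarrow> j = l" if "j < n" "l < n" for j l
    using cy that by (auto simp: fcycle_def dest: inj_onD[of e "{..<n}" j l])
  have conn_arc: "conn (e ` {a..<b})" if "a < b" "b \<le> n" for a b
    using that
  proof (induction b)
    case (Suc b)
    show ?case
    proof (cases "a = b")
      case False
      have "conn (e ` {a..<b} \<union> {e b})"
      proof (rule conn_Un[where x = "v b"])
        show "conn (e ` {a..<b})" using Suc False by simp
        show "v b \<in> \<Union>(e ` {a..<b})"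
          using e(3)[of "b - 1"] Suc.prems False by (intro UnionI[of "e (b - 1)"]) auto
      qed (use e(2)[of b] Suc.prems in auto)
      moreover have "e ` {a..<Suc b} = e ` {a..<b} \<union> {e b}"
        using Suc.prems False by (auto simp: less_Suc_eq)
      ultimately show ?thesis by simp
    qed simp
  qed simp
  have C: "e ` {..<n} \<in> cyc E" using cy by (rule cycI)
  have no_arc: False if A: "A = e ` {a..<b}" "1 \<le> a" "a < b" "b \<le> n"
    and l: "l < n" "l \<notin> {a..<b}" "l \<noteq> 0" and x: "x \<in> e 0" "x \<in> \<Union>A" "y \<in> e 0" "y \<in> \<Union>A" "x \<noteq> y"
    for A a b l x y
  proof -
    have "A \<inter> {e 0} = {}" using A i by (auto simp: inj)
    then obtain D where D: "D \<in> cyc (A \<union> {e 0})" "D \<inter> {e 0} \<noteq> {}"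
      using crossing_cycle[of A "{e 0}" x y] conn_arc[of a b] A x by auto
    have "A \<union> {e 0} \<subseteq> E" using A e(1) i by auto
    then have "D \<in> cyc E" using D(1) cyc_mono by blast
    then have "D = e ` {..<n}" using cyc_eq[OF _ C, of D "e 0"] D(2) i by auto
    then have "e l \<in> A \<union> {e 0}" using cyc_subset[OF D(1)] l(1) by auto
    then show False using A l i by (auto simp: inj)
  qed
  show False
  proof (cases "w = v 1")
    case False
    have "v 1 \<in> \<Union>(e ` {1..<Suc i})" "w \<in> \<Union>(e ` {1..<Suc i})"
      using e(2)[of 1] i w by (auto intro: UnionI[of "e 1"] UnionI[of "e i"])
    moreover have "n - 1 < n" "n - 1 \<notin> {1..<Suc i}" "n - 1 \<noteq> 0" using i by auto
    ultimately show False
      using no_arc[OF refl, of 1 "Suc i" "n - 1" "v 1" w] e(3)[of 0] w(1) i False by simp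
  next
    case True
    have "v n \<in> \<Union>(e ` {i..<n})"
      using e(3)[of "n - 1"] i by (intro UnionI[of "e (n - 1)"]) auto
    moreover have "w \<in> \<Union>(e ` {i..<n})" using i by (intro UnionI[OF _ w(2)]) simp
    moreover have vn: "v n = v 0" and inj_v: "inj_on v {..<n}" using cy unfolding fcycle_def by blast+
    have "v 0 \<noteq> v 1" using inj_on_eq_iff[OF inj_v, of 0 1] i by simp
    then have "v n \<noteq> w" using vn True by simp
    moreover have "v n \<in> e 0" using e(2)[of 0] vn i by simp
    ultimately show False
      using no_arc[OF refl, of i n 1 "v n" w] w(1) i by simp
  qed
qed

section \<open>Cycles as gluing pieces\<close>

lemma cyc_conn:
  assumes "C \<in> cyc E"
  shows "conn C"
proof -
  obtain n v e where cy: "fcycle E n v e" "C = e ` {..<n}" using assms by (rule cycE)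
  have "conn (e ` {..<Suc m})" if "m < n" for m
    using that
  proof (induction m)
    case 0
    then show ?case by (simp add: lessThan_Suc)
  next
    case (Suc m)
    have "v (Suc m) \<in> e m" "v (Suc m) \<in> e (Suc m)" using fcycleD[OF cy(1)] Suc.prems by auto
    then have "conn (e ` {..<Suc m} \<union> {e (Suc m)})"
      using Suc by (intro conn_Un[where x = "v (Suc m)"]) auto
    then show ?case by (simp add: lessThan_Suc)
  qed
  from this[of "n - 1"] show ?thesis using cy by (simp add: fcycle_def)
qed

text \<open>A vertex on the consecutive edges \<open>e 0\<close>, \<open>e 1\<close>,
  \<open>e 2\<close> would by linearity equal both \<open>v 1\<close> and
  \<open>v 2\<close>.\<close>

lemma fcycle_avoid:
  assumes "fcycle E n v e"
  obtains p where "p < n" "r \<notin> e p"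
proof -
  have n: "3 \<le> n" using assms by (rule fcycle_length)
  have e: "e j \<in> E" "v j \<in> e j" "v (Suc j) \<in> e j" if "j < n" for j
    using fcycleD[OF assms] that by auto
  have "\<not> (r \<in> e 0 \<and> r \<in> e 1 \<and> r \<in> e 2)"
  proof
    assume r: "r \<in> e 0 \<and> r \<in> e 1 \<and> r \<in> e 2"
    have ne: "e 0 \<noteq> e 1" "e 1 \<noteq> e 2" "v 1 \<noteq> v 2"
      using fcycle_inj[OF assms, of 0 1] fcycle_inj[OF assms, of 1 2] n by auto
    have "r = v 1" using linear_eq[of "e 0" "e 1" r "v 1"] e[of 0] e[of 1] r n ne by auto
    moreover have "r = v 2"
      using linear_eq[of "e 1" "e 2" r "v 2"] e[of 1] e[of 2] r n ne by (auto simp: numeral_2_eq_2)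
    ultimately show False using ne by simp
  qed
  then show thesis using that[of 0] that[of 1] that[of 2] n by fastforce
qed

text \<open>An edge avoiding \<open>r\<close> is rotated to index 0. Its neighbours
  \<open>e 1\<close> and \<open>e (n - 1)\<close> serve as \<open>a\<close> and \<open>b\<close>,
  and the other edges are disjoint from it by \<open>chordless\<close>; \<open>R\<close> is empty
  exactly for a triangle, where \<open>a\<close> and \<open>b\<close> meet at
  \<open>v 2\<close>.\<close>

lemma cyc_ringlike:
  assumes "C \<in> cyc E"
  shows "ringlike C"
  unfolding ringlike_def
proof
  fix r
  obtain n v0 e0 where cy0: "fcycle E n v0 e0" "C = e0 ` {..<n}" using assms by (rule cycE)
  obtain p where p: "p < n" "r \<notin> e0 p" using fcycle_avoid[OF cy0(1)] by blast
  define v where "v = (\<lambda>i. v0 ((i + p) mod n))"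
  define e where "e = (\<lambda>i. e0 ((i + p) mod n))"
  have cy: "fcycle E n v e" "C = e ` {..<n}" and r: "r \<notin> e 0"
    using fcycle_shift[OF cy0(1), of p] cy0(2) p by (auto simp: v_def e_def)
  have n: "3 \<le> n" using cy(1) by (rule fcycle_length)
  have inj: "e j = e l \<longleftrightarrow> j = l" if "j < n" "l < n" for j l
    using cy that by (auto simp: fcycle_def dest: inj_onD[of e "{..<n}" j l])
  define R where "R = e ` {2..<n - 1}"
  have "{..<n} = {0, 1, n - 1} \<union> {2..<n - 1}" using n by auto
  then have "C = {e 0, e 1, e (n - 1)} \<union> R" unfolding cy(2) R_def by (simp add: image_Un)
  moreover have "finite R" "e 0 \<noteq> e 1" "e 0 \<noteq> e (n - 1)" "e 1 \<noteq> e (n - 1)"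
    "{e 0, e 1, e (n - 1)} \<inter> R = {}"
    using n by (auto simp: R_def inj)
  moreover have "\<forall>f\<in>R. disjnt (e 0) f"
    using chordless[OF cy(1)] by (auto simp: R_def)
  moreover have "disjnt (e 1) (e (n - 1)) \<longleftrightarrow> R \<noteq> {}"
  proof (cases "n = 3")
    case True
    have "v 2 \<in> e 1" "v 2 \<in> e (n - 1)"
      using cy(1) True unfolding fcycle_def by (auto simp: numeral_2_eq_2 numeral_3_eq_3)
    then show ?thesis using True by (auto simp: disjnt_iff R_def)
  next
    case False
    \<comment> \<open>After rotation by one, the pair \<open>e 1\<close>, \<open>e (n - 1)\<close>
      sits at the indices 0 and \<open>n - 2\<close>.\<close>
    have "disjnt (e ((0 + 1) mod n)) (e ((n - 2 + 1) mod n))"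
      by (rule chordless[OF fcycle_shift(1)[OF cy(1)]]) (use n False in auto)
    moreover have "n - 2 + 1 = n - 1" using n by simp
    ultimately show ?thesis using n False by (simp add: R_def)
  qed
  ultimately show "\<exists>c a b R. C = {c, a, b} \<union> R \<and> finite R \<and> c \<noteq> a \<and> c \<noteq> b \<and> a \<noteq> b \<and>
      {c, a, b} \<inter> R = {} \<and> r \<notin> c \<and> (\<forall>e\<in>R. disjnt c e) \<and> (disjnt a b \<longleftrightarrow> R \<noteq> {})"
    using r by blast
qed

lemma finite_cyc: "finite (cyc E)"
  by (rule finite_subset[of _ "Pow E"]) (use fin cyc_subset in auto)

text \<open>Two common vertices would produce a cycle with edges in both parts. This supplies the
  gluing vertex.\<close>

lemma meet_at_most_once:
  assumes "A \<subseteq> E" "B \<subseteq> E" "conn A" "conn B" "A \<inter> B = {}"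
    and "\<And>D. D \<in> cyc E \<Longrightarrow> D \<inter> A = {} \<or> D \<inter> B = {}"
  obtains r where "\<Union>B \<inter> \<Union>A \<subseteq> {r}"
proof -
  have "x = y" if "x \<in> \<Union>B \<inter> \<Union>A" "y \<in> \<Union>B \<inter> \<Union>A" for x y
  proof (rule ccontr)
    assume ne: "x \<noteq> y"
    have xy: "x \<in> \<Union>A" "x \<in> \<Union>B" "y \<in> \<Union>A" "y \<in> \<Union>B" using that by auto
    obtain D where "D \<in> cyc (A \<union> B)" "D \<inter> A \<noteq> {}" "D \<inter> B \<noteq> {}"
      by (rule crossing_cycle[OF assms(3-5) xy ne])
    then show False using assms(1,2,6) cyc_mono[of "A \<union> B" E] by blast
  qed
  then show thesis using that by (cases "\<Union>B \<inter> \<Union>A = {}") blast+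
qed

text \<open>The last clause forbids cutting a cycle of \<open>E\<close>, so that a missing edge on a
  cycle means that the whole cycle is missing.\<close>

definition closed_part :: "'a set set \<Rightarrow> bool" where
  "closed_part A \<longleftrightarrow> A \<subseteq> E \<and> conn A \<and> glued A (card (cyc A)) \<and>
     (\<forall>C\<in>cyc E. C \<subseteq> A \<or> C \<inter> A = {})"

lemma frontier_edge:
  assumes "conn E" "A \<subset> E"
  obtains e where "e \<in> E - A" "A = {} \<or> (\<exists>x\<in>e. x \<in> \<Union>A)"
proof (cases "A = {}")
  case True
  then show thesis using assms(2) that by blast
next
  case False
  obtain f where f: "f \<in> E - A" using assms(2) by blast
  then obtain y where y: "y \<in> f" using edge_nonempty by fastforce
  obtain g where gA: "g \<in> A" using False by blast
  then have "g \<in> E" using assms(2) by blast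
  then obtain x where g: "g \<in> A" "x \<in> g" using edge_nonempty gA by fastforce
  have "(x, y) \<in> (adj E)\<^sup>*"
    by (rule connD[OF assms(1)]) (use f g y assms(2) in auto)
  \<comment> \<open>Along the walk one is still inside \<open>A\<close> or has already met an
    outside edge that touches \<open>A\<close>.\<close>
  then have "y \<in> \<Union>A \<or> (\<exists>e\<in>E - A. \<exists>x\<in>e. x \<in> \<Union>A)"
  proof (induction rule: rtrancl_induct)
    case (step y z)
    then obtain e where "e \<in> E" "y \<in> e" "z \<in> e" by (auto simp: adj_def)
    then show ?case using step.IH by (cases "e \<in> A") blast+
  qed (use g in blast)
  then show thesis using that f y by blast
qed

text \<open>If the frontier edge \<open>e\<close> lies on a cycle, the whole cycle is glued,
  otherwise \<open>e\<close> alone. No cycle of \<open>E\<close> uses edges of both \<open>A\<close>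
  and the new piece: in the first case it would be the new cycle itself, which is disjoint from
  \<open>A\<close>, and in the second \<open>e\<close> lies on no cycle.\<close>

lemma closed_part_extend:
  assumes "conn E" "closed_part A" "A \<subset> E"
  obtains A' where "closed_part A'" "A \<subset> A'"
proof -
  have A: "A \<subseteq> E" "conn A" "glued A (card (cyc A))" "\<And>C. C \<in> cyc E \<Longrightarrow> C \<subseteq> A \<or> C \<inter> A = {}"
    using assms(2) by (auto simp: closed_part_def)
  have finA: "finite (cyc A)" using finite_subset[OF cyc_mono[OF A(1)] finite_cyc] .
  obtain e where "e \<in> E - A" and e3: "A = {} \<or> (\<exists>x\<in>e. x \<in> \<Union>A)"
    by (rule frontier_edge[OF assms(1,3)])
  then have e: "e \<in> E" "e \<notin> A" by auto
  have connB: "conn (B \<union> A)" if "conn B" "e \<in> B" for B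
  proof (cases "A = {}")
    case True
    then show ?thesis using that by simp
  next
    case False
    then obtain x where "x \<in> e" "x \<in> \<Union>A" using e3 by blast
    then show ?thesis using conn_Un[OF that(1) A(2), of x] that(2) by blast
  qed
  show thesis
  proof (cases "\<exists>C\<in>cyc E. e \<in> C")
    case True
    then obtain C where C: "C \<in> cyc E" "e \<in> C" by blast
    have sub: "C \<subseteq> E" using cyc_subset[OF C(1)] .
    have dis: "C \<inter> A = {}" using A(4)[OF C(1)] C(2) e(2) by blast
    have only: "D = C" if "D \<in> cyc E" "D \<inter> C \<noteq> {}" for D
      using cyc_eq[OF that(1) C(1)] that(2) by blast
    obtain r where r: "\<Union>C \<inter> \<Union>A \<subseteq> {r}"
      by (rule meet_at_most_once[OF A(1) sub A(2) cyc_conn[OF C(1)]]) (use dis only in auto)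
    have "cyc (C \<union> A) = insert C (cyc A)"
    proof (intro equalityI subsetI)
      fix D assume D: "D \<in> cyc (C \<union> A)"
      then have D': "D \<in> cyc E" using cyc_mono[of "C \<union> A" E] sub A(1) by blast
      show "D \<in> insert C (cyc A)"
      proof (cases "D \<inter> C = {}")
        case True
        then show ?thesis using cyc_restrict[OF D, of A] cyc_subset[OF D] by blast
      qed (use only[OF D'] in auto)
    next
      fix D assume "D \<in> insert C (cyc A)"
      then show "D \<in> cyc (C \<union> A)"
        using cyc_restrict[OF C(1), of "C \<union> A"] cyc_mono[of A "C \<union> A"] by blast
    qed
    moreover have "C \<notin> cyc A" using cyc_subset[of C A] C(2) e(2) by blast
    ultimately have "card (cyc (C \<union> A)) = Suc (card (cyc A))" using finA by simp
    then have "glued (C \<union> A) (card (cyc (C \<union> A)))"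
      using glued.ring[OF A(3) dis r cyc_ringlike[OF C(1)]] by simp
    moreover have "D \<subseteq> C \<union> A \<or> D \<inter> (C \<union> A) = {}" if "D \<in> cyc E" for D
      using only[OF that] A(4)[OF that] by blast
    ultimately have "closed_part (C \<union> A)"
      using sub A(1) connB[OF cyc_conn[OF C(1)] C(2)] by (simp add: closed_part_def)
    then show thesis using that[of "C \<union> A"] C(2) e(2) by blast
  next
    case False
    obtain r where r: "\<Union>{e} \<inter> \<Union>A \<subseteq> {r}"
      by (rule meet_at_most_once[OF A(1) _ A(2) conn_single]) (use e False in auto)
    have "cyc (insert e A) = cyc A"
    proof (intro equalityI subsetI)
      fix D assume D: "D \<in> cyc (insert e A)"
      then have "D \<in> cyc E" using cyc_mono[of "insert e A" E] e(1) A(1) by blast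
      then show "D \<in> cyc A" using cyc_restrict[OF D, of A] cyc_subset[OF D] False by blast
    qed (use cyc_mono[of A "insert e A"] in blast)
    moreover have "e \<noteq> {}" using edge_nonempty[OF e(1)] .
    ultimately have "glued (insert e A) (card (cyc (insert e A)))"
      using glued.edge[OF A(3) e(2)] r by simp
    moreover have "D \<subseteq> insert e A \<or> D \<inter> insert e A = {}" if "D \<in> cyc E" for D
      using False A(4)[OF that] that by blast
    ultimately have "closed_part (insert e A)"
      using e(1) A(1) connB[of "{e}"] by (simp add: closed_part_def)
    then show thesis using that[of "insert e A"] e(2) by blast
  qed
qed

theorem connected_glued:
  assumes "conn E"
  shows "glued E (card (cyc E))"
proof -
  have "cyc {} = ({} :: 'a set set set)"
    using cyc_subset cyc_card by fastforce
  then have "closed_part {}"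
    by (auto simp: closed_part_def conn_def intro: glued.empty)
  moreover have "\<And>A. closed_part A \<Longrightarrow> card A < Suc (card E)"
    using fin by (simp add: closed_part_def card_mono less_Suc_eq_le)
  ultimately obtain A where A: "closed_part A" "\<And>B. closed_part B \<Longrightarrow> card B \<le> card A"
    using ex_has_greatest_nat[of closed_part "{}" card "Suc (card E)"] by (metis less_imp_le)
  have "A = E"
  proof (rule ccontr)
    assume "A \<noteq> E"
    then have "A \<subset> E" using A(1) by (auto simp: closed_part_def)
    from closed_part_extend[OF assms A(1) this] obtain B where B: "closed_part B" "A \<subset> B" .
    moreover have "finite B" using B(1) fin finite_subset by (auto simp: closed_part_def)
    ultimately have "card A < card B" by (simp add: psubset_card_mono)
    then show False using A(2)[OF B(1)] by simp
  qed
  then show ?thesis using A(1) by (simp add: closed_part_def)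
qed

end

section \<open>Hypergraphs and their matching polynomials\<close>

lemma is_cycle_fcycle:
  assumes "is_cycle H vs es"
  shows "fcycle (edges H) (length es) (nth vs) (nth es)"
proof -
  define n where "n = length es"
  have len: "length vs = Suc n" and es: "distinct es" "set es \<subseteq> edges H" and n: "2 \<le> n"
    and inc: "\<And>i. i < n \<Longrightarrow> vs ! i \<in> es ! i \<and> vs ! Suc i \<in> es ! i"
    and d: "distinct (tl vs)" and closed: "hd vs = last vs"
    using assms by (auto simp: is_cycle_def alternating_def n_def)
  have "vs \<noteq> []" using len by auto
  then have 0: "vs ! n = vs ! 0" using closed len by (simp add: hd_conv_nth last_conv_nth)
  have "inj_on (nth vs) {..<n}"
  proof (rule linorder_inj_onI')
    fix i j assume ij: "i \<in> {..<n}" "j \<in> {..<n}" "i < j"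
    \<comment> \<open>Distinctness is known for the indices 1 to \<open>n\<close>, while
      \<open>fcycle\<close> uses 0 to \<open>n - 1\<close>; index 0 is replaced by \<open>n\<close>,
      which carries the same vertex.\<close>
    define i' where "i' = (if i = 0 then n else i)"
    have "tl vs ! (i' - 1) \<noteq> tl vs ! (j - 1)"
      using d ij len unfolding i'_def by (subst nth_eq_iff_index_eq) auto
    moreover have "tl vs ! (i' - 1) = vs ! i'" "tl vs ! (j - 1) = vs ! j"
      using ij len n by (auto simp: nth_tl i'_def)
    moreover have "vs ! i' = vs ! i" using 0 by (simp add: i'_def)
    ultimately show "vs ! i \<noteq> vs ! j" by simp
  qed
  moreover have "inj_on (nth es) {..<n}"
    using es(1) by (simp add: inj_on_nth n_def)
  ultimately show ?thesis
    using n 0 inc es(2) unfolding fcycle_def n_def[symmetric] by (auto simp: n_def subset_iff)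
qed

lemma fcycle_is_cycle:
  assumes "fcycle (edges H) n v e" "\<Union>(edges H) \<subseteq> verts H"
  shows "is_cycle H (map v [0..<Suc n]) (map e [0..<n])"
proof -
  have n: "2 \<le> n" and c: "v n = v 0" and inj: "inj_on v {..<n}" "inj_on e {..<n}"
    and e: "\<And>i. i < n \<Longrightarrow> e i \<in> edges H" "\<And>i. i < n \<Longrightarrow> v i \<in> e i" "\<And>i. i < n \<Longrightarrow> v (Suc i) \<in> e i"
    using assms(1) unfolding fcycle_def by blast+
  have verts: "v i \<in> verts H" if "i < n" for i using e[OF that] assms(2) by blast
  then have "v n \<in> verts H" using c n by simp
  moreover have "distinct (tl (map v [0..<Suc n]))"
  proof -
    have "tl (map v [0..<Suc n]) = map v [1..<Suc n]" by (simp add: upt_conv_Cons del: upt_Suc)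
    moreover have "inj_on v {1..<Suc n}"
    proof (rule linorder_inj_onI')
      fix i j assume ij: "i \<in> {1..<Suc n}" "j \<in> {1..<Suc n}" "i < j"
      define j' where "j' = (if j = n then 0 else j)"
      have "v i \<noteq> v j'" using inj_on_eq_iff[OF inj(1), of i j'] ij n by (auto simp: j'_def)
      then show "v i \<noteq> v j" using c by (auto simp: j'_def split: if_splits)
    qed
    ultimately show ?thesis by (simp add: distinct_map del: upt_Suc)
  qed
  moreover have "set (map v [0..<Suc n]) \<subseteq> verts H"
    using verts \<open>v n \<in> verts H\<close> by auto
  moreover have "distinct (map e [0..<n])" using inj(2) by (simp add: distinct_map atLeast0LessThan)
  moreover have "hd (map v [0..<Suc n]) = last (map v [0..<Suc n])"
    using c by (simp add: hd_map last_map del: upt_Suc)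
  ultimately show ?thesis
    unfolding is_cycle_def alternating_def using e n
    by (auto simp: nth_append simp del: upt_Suc)
qed

lemma cycles_eq:
  assumes "\<Union>(edges H) \<subseteq> verts H"
  shows "cycles H = (\<lambda>C. Hypergraph (\<Union>C) C) ` cyc (edges H)"
proof (intro equalityI subsetI)
  fix D assume "D \<in> cycles H"
  then obtain vs es where D: "D = Hypergraph (\<Union>(set es)) (set es)" "is_cycle H vs es"
    by (auto simp: cycles_def)
  have "nth es ` {..<length es} \<in> cyc (edges H)" by (rule cycI[OF is_cycle_fcycle[OF D(2)]])
  moreover have "nth es ` {..<length es} = set es" by (auto simp: set_conv_nth)
  ultimately show "D \<in> (\<lambda>C. Hypergraph (\<Union>C) C) ` cyc (edges H)" using D(1) by auto
next
  fix D assume "D \<in> (\<lambda>C. Hypergraph (\<Union>C) C) ` cyc (edges H)"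
  then obtain C where C: "C \<in> cyc (edges H)" "D = Hypergraph (\<Union>C) C" by blast
  from C(1) obtain n v e where c: "fcycle (edges H) n v e" "C = e ` {..<n}" by (rule cycE)
  have "C = set (map e [0..<n])" using c(2) by auto
  then show "D \<in> cycles H"
    using fcycle_is_cycle[OF c(1) assms] C(2) unfolding cycles_def by blast
qed

lemma connected_hypergraph_iff:
  assumes "\<Union>(edges H) \<subseteq> verts H"
  shows "connected_hypergraph H \<longleftrightarrow>
    verts H \<noteq> {} \<and> (\<forall>x\<in>verts H. \<forall>y\<in>verts H. (x, y) \<in> (adj (edges H))\<^sup>*)"
proof -
  have "(\<exists>vs es. is_path H vs es \<and> hd vs = x \<and> last vs = y) \<longleftrightarrow> (x, y) \<in> (adj (edges H))\<^sup>*"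
    if xy: "x \<in> verts H" "y \<in> verts H" for x y
  proof
    assume "\<exists>vs es. is_path H vs es \<and> hd vs = x \<and> last vs = y"
    then obtain vs es where p: "length vs = Suc (length es)" "set es \<subseteq> edges H"
      "\<And>i. i < length es \<Longrightarrow> vs ! i \<in> es ! i \<and> vs ! Suc i \<in> es ! i" "hd vs = x" "last vs = y"
      by (auto simp: is_path_def alternating_def)
    have "(vs ! 0, vs ! i) \<in> (adj (edges H))\<^sup>*" if "i \<le> length es" for i
      using that
    proof (induction i)
      case (Suc i)
      have "es ! i \<in> edges H" using Suc.prems p(2) by (simp add: subset_iff)
      then have "(vs ! i, vs ! Suc i) \<in> adj (edges H)"
        using p(3)[of i] Suc.prems by (auto simp: adj_def)
      then show ?case using Suc by (simp add: rtrancl.rtrancl_into_rtrancl)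
    qed simp
    moreover have "vs \<noteq> []" using p(1) by auto
    ultimately show "(x, y) \<in> (adj (edges H))\<^sup>*"
      using p(1,4,5) by (force simp: hd_conv_nth last_conv_nth)
  next
    assume "(x, y) \<in> (adj (edges H))\<^sup>*"
    then obtain n v e where P: "fpath (edges H) n v e" "(v 0, v n) \<in> {(x, y)}"
      by (rule shortest_path[where Z = "{(x, y)}"]) auto
    have e: "\<And>i. i < n \<Longrightarrow> e i \<in> edges H" "\<And>i. i < n \<Longrightarrow> v i \<in> e i" "\<And>i. i < n \<Longrightarrow> v (Suc i) \<in> e i"
      and inj: "inj_on v {..n}" "inj_on e {..<n}"
      using P(1) unfolding fpath_def by blast+
    have "v i \<in> verts H" if "i \<le> n" for i
    proof (cases "i = n")
      case True
      then show ?thesis using P(2) xy by simp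
    next
      case False
      then show ?thesis using e(1,2)[of i] assms that by auto
    qed
    then have "set (map v [0..<Suc n]) \<subseteq> verts H" by auto
    moreover have "distinct (map v [0..<Suc n])"
      using inj(1) by (simp add: distinct_map atLeast0LessThan lessThan_Suc_atMost del: upt_Suc)
    moreover have "distinct (map e [0..<n])"
      using inj(2) by (simp add: distinct_map atLeast0LessThan)
    moreover have "hd (map v [0..<Suc n]) = x" "last (map v [0..<Suc n]) = y"
      using P(2) by (simp_all add: hd_map last_map del: upt_Suc)
    ultimately have "is_path H (map v [0..<Suc n]) (map e [0..<n])"
      using e unfolding is_path_def alternating_def by (auto simp del: upt_Suc)
    then show "\<exists>vs es. is_path H vs es \<and> hd vs = x \<and> last vs = y"
      using \<open>hd (map v [0..<Suc n]) = x\<close> \<open>last (map v [0..<Suc n]) = y\<close> by blast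
  qed
  then show ?thesis by (auto simp: connected_hypergraph_def)
qed

lemma LCa_iff:
  "H \<in> LCa k m t \<longleftrightarrow> kgraph k H \<and> verts H \<noteq> {} \<and>
    (\<forall>x\<in>verts H. \<forall>y\<in>verts H. (x, y) \<in> (adj (edges H))\<^sup>*) \<and> linear_hypergraph H \<and>
    (\<forall>C\<in>cyc (edges H). \<forall>D\<in>cyc (edges H). C \<noteq> D \<longrightarrow> card (\<Union>C \<inter> \<Union>D) \<le> 1) \<and>
    card (edges H) = m \<and> card (cyc (edges H)) = t"
proof (cases "kgraph k H")
  case True
  then have sub: "\<Union>(edges H) \<subseteq> verts H" by (auto simp: kgraph_def)
  have inj: "inj_on (\<lambda>C. Hypergraph (\<Union>C) C) (cyc (edges H))" by (auto intro: inj_onI)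
  have heq: "Hypergraph (\<Union>C) C = Hypergraph (\<Union>D) D \<longleftrightarrow> C = D" for C D :: "'a set set" by auto
  show ?thesis
    unfolding LCa_def mem_Collect_eq kcactus_def
    unfolding cycles_eq[OF sub] connected_hypergraph_iff[OF sub] card_image[OF inj] ball_simps
    using True by (auto simp: heq simp del: hypergraph.inject)
qed (auto simp: LCa_def kcactus_def)

lemma kgraph_finite_edges: "kgraph k H \<Longrightarrow> finite (edges H)"
  by (rule finite_subset[of _ "Pow (verts H)"]) (auto simp: kgraph_def)

lemma LCa_linear_cactus:
  assumes "2 \<le> k" "H \<in> LCa k m t"
  shows "linear_cactus (edges H)"
  using assms kgraph_finite_edges
  by unfold_locales (auto simp: LCa_iff kgraph_def linear_hypergraph_def)

lemma LCa_glued: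
  assumes "2 \<le> k" "H \<in> LCa k m t"
  shows "glued (edges H) t"
proof -
  interpret linear_cactus "edges H" using LCa_linear_cactus[OF assms] .
  have "conn (edges H)"
    using assms(2) unfolding LCa_iff conn_def kgraph_def by blast
  then show ?thesis using connected_glued assms(2) by (auto simp: LCa_iff)
qed

section \<open>Roots of the matching polynomial and zeros of \<open>mgen\<close>\<close>

lemma mgen_of_real: "mgen E (of_real b :: 'b::real_normed_field) = of_real (mgen E b)"
  by (simp add: mgen_def)

lemma mgen_by_size:
  assumes "finite (edges H)"
  shows "mgen (edges H) w = (\<Sum>r\<le>card (edges H). of_nat (card (matchings H r)) * (- w) ^ r)"
proof -
  have "mgen (edges H) w =
      (\<Sum>r\<le>card (edges H). \<Sum>M\<in>{M \<in> mats (edges H). card M = r}. (- w) ^ card M)"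
    unfolding mgen_def using assms
    by (subst sum.group) (auto simp: finite_mats mats_def card_mono)
  also have "\<dots> = (\<Sum>r\<le>card (edges H). of_nat (card (matchings H r)) * (- w) ^ r)"
  proof (rule sum.cong[OF refl])
    fix r
    have "{M \<in> mats (edges H). card M = r} = matchings H r"
      by (auto simp: mats_def matchings_def)
    moreover have "(\<Sum>M\<in>{M \<in> mats (edges H). card M = r}. (- w) ^ card M) =
        (\<Sum>M\<in>{M \<in> mats (edges H). card M = r}. (- w) ^ r)"
      by (rule sum.cong) auto
    ultimately show "(\<Sum>M\<in>{M \<in> mats (edges H). card M = r}. (- w) ^ card M) =
        of_nat (card (matchings H r)) * (- w) ^ r" by simp
  qed
  finally show ?thesis .
qed

text \<open>Makes the truncated subtraction in the exponent of the polynomial genuine whenever the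
  coefficient is nonzero.\<close>

lemma matchings_size:
  assumes "kgraph k H" "M \<in> matchings H r"
  shows "k * r \<le> card (verts H)"
proof -
  have M: "M \<subseteq> edges H" "card M = r" "pairwise disjnt M" using assms(2) by (auto simp: matchings_def)
  have H: "finite (verts H)" "\<And>e. e \<in> M \<Longrightarrow> e \<subseteq> verts H \<and> card e = k"
    using assms(1) M(1) by (auto simp: kgraph_def)
  have "card (\<Union>M) = sum card M"
    using M(3) H by (intro card_Union_disjoint) (auto intro: finite_subset)
  also have "\<dots> = k * r" using H M(2) by simp
  finally show ?thesis using card_mono[OF H(1), of "\<Union>M"] H(2) by fastforce
qed

lemma poly_matching_poly:
  assumes "kgraph k H" "x \<noteq> 0"
  shows "poly (matching_poly k H) x = x ^ card (verts H) * mgen (edges H) (inverse (x ^ k))"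
proof -
  have "(- 1) ^ r * of_nat (card (matchings H r)) * x ^ (card (verts H) - k * r) =
      x ^ card (verts H) * (of_nat (card (matchings H r)) * (- inverse (x ^ k)) ^ r)" for r
  proof (cases "matchings H r = {}")
    case False
    then obtain M where "M \<in> matchings H r" by blast
    then have "k * r \<le> card (verts H)" by (rule matchings_size[OF assms(1)])
    then have "x ^ (card (verts H) - k * r) = x ^ card (verts H) * inverse (x ^ k) ^ r"
      using assms(2) by (simp add: power_diff power_mult divide_inverse power_inverse)
    moreover have "(- inverse (x ^ k)) ^ r = (- 1) ^ r * inverse (x ^ k) ^ r"
      by (metis mult_minus1 power_mult_distrib)
    ultimately show ?thesis by simp
  qed simp
  then show ?thesis
    unfolding matching_poly_def mgen_by_size[OF kgraph_finite_edges[OF assms(1)]]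
      poly_sum poly_monom sum_distrib_left by (intro sum.cong refl)
qed

text \<open>\<open>Max\<close> in \<open>max_root\<close> is meaningful only on a finite nonempty
  set. The term for \<open>r = 0\<close> alone has the exponent \<open>card (verts H)\<close>, with
  coefficient 1, so the polynomial is nonzero and not constant.\<close>

lemma matching_poly_roots:
  assumes "kgraph k H" "2 \<le> k" "verts H \<noteq> {}"
  shows "finite {z. poly (matching_poly k H) z = 0}" "{z. poly (matching_poly k H) z = 0} \<noteq> {}"
proof -
  have fin: "finite (verts H)" using assms(1) by (simp add: kgraph_def)
  then have pos: "card (verts H) > 0" using assms(3) by (simp add: card_gt_0_iff)
  have m0: "matchings H 0 = {{}}"
    using kgraph_finite_edges[OF assms(1)] by (auto simp: matchings_def finite_subset)
  have "card (verts H) - k * r \<noteq> card (verts H)" if "0 < r" for r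
  proof -
    have "0 < k * r" using assms(2) that by simp
    from diff_less[OF this pos] show ?thesis by linarith
  qed
  then have "coeff (matching_poly k H) (card (verts H)) =
      (\<Sum>r\<in>{0}. (- 1) ^ r * of_nat (card (matchings H r)))"
    unfolding matching_poly_def coeff_sum using pos assms(2)
    by (intro sum.mono_neutral_cong_right) auto
  with m0 have c: "coeff (matching_poly k H) (card (verts H)) = 1" by simp
  then have "matching_poly k H \<noteq> 0" by auto
  then show "finite {z. poly (matching_poly k H) z = 0}" by (rule poly_roots_finite)
  have "degree (matching_poly k H) \<ge> card (verts H)" using c by (intro le_degree) simp
  then have "\<not> constant (poly (matching_poly k H))" using pos by (simp add: constant_degree)
  then show "{z. poly (matching_poly k H) z = 0} \<noteq> {}"
    using fundamental_theorem_of_algebra by blast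
qed

lemma max_root_attained:
  assumes "kgraph k H" "2 \<le> k" "verts H \<noteq> {}"
  obtains x where "poly (matching_poly k H) x = 0" "max_root k H = cmod x"
proof -
  have "max_root k H \<in> cmod ` {z. poly (matching_poly k H) z = 0}"
    unfolding max_root_def by (rule Max_in) (use matching_poly_roots[OF assms] in auto)
  then show thesis using that by blast
qed

text \<open>A nonzero root \<open>x\<close> gives the zero \<open>inverse (x ^ k)\<close>, which
  must lie outside the disc of radius \<open>b\<close>; the root 0 is harmless because the bound is
  positive.\<close>

lemma max_root_less:
  assumes "kgraph k H" "2 \<le> k" "verts H \<noteq> {}" "0 < b"
    and "\<And>w::complex. cmod w \<le> b \<Longrightarrow> mgen (edges H) w \<noteq> 0"
  shows "max_root k H < root k (1 / b)"
proof -
  obtain x where x: "poly (matching_poly k H) x = 0" "max_root k H = cmod x"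
    using max_root_attained[OF assms(1-3)] .
  show ?thesis
  proof (cases "x = 0")
    case True
    then show ?thesis using x(2) assms(2,4) by simp
  next
    case False
    then have "mgen (edges H) (inverse (x ^ k)) = 0"
      using x(1) poly_matching_poly[OF assms(1)] by simp
    then have "b < cmod (inverse (x ^ k))" using assms(5) by force
    then have "b < 1 / cmod x ^ k" by (simp add: norm_inverse norm_power divide_inverse)
    then have "cmod x ^ k < 1 / b" using assms(4) False by (simp add: field_simps)
    then have "root k (cmod x ^ k) < root k (1 / b)" using assms(2) by simp
    then show ?thesis using assms(2) x(2) by (simp add: real_root_power_cancel)
  qed
qed

lemma max_root_le:
  assumes "kgraph k H" "2 \<le> k" "verts H \<noteq> {}" "0 < b"
    and "\<And>w::complex. cmod w < b \<Longrightarrow> mgen (edges H) w \<noteq> 0"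
  shows "max_root k H \<le> root k (1 / b)"
proof -
  obtain x where x: "poly (matching_poly k H) x = 0" "max_root k H = cmod x"
    using max_root_attained[OF assms(1-3)] .
  show ?thesis
  proof (cases "x = 0")
    case True
    then show ?thesis using x(2) assms(2,4) by simp
  next
    case False
    then have "mgen (edges H) (inverse (x ^ k)) = 0"
      using x(1) poly_matching_poly[OF assms(1)] by simp
    then have "b \<le> cmod (inverse (x ^ k))" using assms(5) by force
    then have "b \<le> 1 / cmod x ^ k" by (simp add: norm_inverse norm_power divide_inverse)
    then have "cmod x ^ k \<le> 1 / b" using assms(4) False by (simp add: field_simps)
    then have "root k (cmod x ^ k) \<le> root k (1 / b)" using assms(2) by simp
    then show ?thesis using assms(2) x(2) by (simp add: real_root_power_cancel)
  qed
qed

lemma max_root_ge: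
  assumes "kgraph k H" "2 \<le> k" "verts H \<noteq> {}" "0 < b" "mgen (edges H) b = 0"
  shows "root k (1 / b) \<le> max_root k H"
proof -
  define y where "y = root k (1 / b)"
  have y: "y > 0" "y ^ k = 1 / b" using assms(2,4) by (auto simp: y_def)
  have "inverse ((complex_of_real y) ^ k) = of_real b"
    using y(2) by (simp flip: of_real_power)
  then have "poly (matching_poly k H) (of_real y) = 0"
    using poly_matching_poly[OF assms(1), of "of_real y"] y(1) assms(5) by (simp add: mgen_of_real)
  then have "cmod (of_real y) \<le> max_root k H"
    unfolding max_root_def using matching_poly_roots(1)[OF assms(1-3)]
    by (intro Max_ge imageI finite_imageI) simp_all
  then show ?thesis using y(1) by (simp add: y_def)
qed

section \<open>Isomorphic copies\<close>

lemma disjnt_image_iff: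
  assumes "inj_on f V" "a \<subseteq> V" "b \<subseteq> V"
  shows "disjnt (f ` a) (f ` b) \<longleftrightarrow> disjnt a b"
  using inj_on_image_Int[OF assms] unfolding disjnt_def by (metis image_is_empty)

lemma image_left_inverse: "(\<And>x. x \<in> A \<Longrightarrow> h (k x) = x) \<Longrightarrow> h ` (k ` A) = A"
  by force

lemma image_cyc:
  assumes "inj_on f V" "\<Union>E \<subseteq> V" "C \<in> cyc E"
  shows "(`) f ` C \<in> cyc ((`) f ` E)"
proof -
  obtain n v e where c: "fcycle E n v e" "C = e ` {..<n}" using assms(3) by (rule cycE)
  have "e i \<subseteq> V" if "i < n" for i using fcycleD(3)[OF c(1) that] assms(2) by blast
  then have "e ` {..<n} \<subseteq> Pow V" by blast
  moreover have "v i \<in> V" if "i < n" for i using fcycleD(3,4)[OF c(1) that] assms(2) by blast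
  then have "v ` {..<n} \<subseteq> V" by blast
  ultimately have "inj_on ((`) f) (e ` {..<n})" "inj_on f (v ` {..<n})"
    by (simp_all add: inj_on_subset[OF inj_on_image_Pow[OF assms(1)]] inj_on_subset[OF assms(1)])
  moreover have "inj_on v {..<n}" "inj_on e {..<n}" using c(1) unfolding fcycle_def by blast+
  ultimately have "inj_on (f \<circ> v) {..<n}" "inj_on ((`) f \<circ> e) {..<n}"
    by (simp_all add: comp_inj_on)
  then have "fcycle ((`) f ` E) n (f \<circ> v) ((`) f \<circ> e)"
    using fcycleD[OF c(1)] unfolding fcycle_def by auto
  then have "((`) f \<circ> e) ` {..<n} \<in> cyc ((`) f ` E)" by (rule cycI)
  then show ?thesis by (simp add: c(2) image_comp)
qed

lemma cyc_image:
  assumes "inj_on f V" "\<Union>E \<subseteq> V"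
  shows "cyc ((`) f ` E) = (`) ((`) f) ` cyc E"
proof (intro equalityI subsetI)
  fix D assume D: "D \<in> cyc ((`) f ` E)"
  \<comment> \<open>The reverse inclusion comes from applying \<open>image_cyc\<close> to the
    inverse map.\<close>
  define g where "g = inv_into V f"
  have g: "g ` (f ` e) = e" if "e \<subseteq> V" for e
    unfolding g_def using inv_into_image_cancel[OF assms(1) that] .
  have EV: "e \<subseteq> V" if "e \<in> E" for e using assms(2) that by blast
  have E: "(`) g ` ((`) f ` E) = E" by (rule image_left_inverse) (rule g[OF EV])
  have "(`) g ` D \<in> cyc ((`) g ` ((`) f ` E))"
    by (rule image_cyc[OF _ _ D, of g "f ` V"])
      (use assms(2) in \<open>auto simp: g_def inj_on_inv_into\<close>)
  then have "(`) g ` D \<in> cyc E" unfolding E .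
  moreover have "(`) f ` ((`) g ` D) = D"
  proof -
    have "f ` (g ` d) = d" if "d \<in> D" for d
    proof -
      from that cyc_subset[OF D] obtain e where "e \<in> E" "d = f ` e" by blast
      then show ?thesis using g EV by simp
    qed
    then show ?thesis by (rule image_left_inverse)
  qed
  ultimately show "D \<in> (`) ((`) f) ` cyc E" by (metis image_eqI)
next
  fix D assume "D \<in> (`) ((`) f) ` cyc E"
  then show "D \<in> cyc ((`) f ` E)" using image_cyc[OF assms] by blast
qed

lemma adj_image:
  assumes "(x, y) \<in> (adj E)\<^sup>*"
  shows "(f x, f y) \<in> (adj ((`) f ` E))\<^sup>*"
  using assms
proof (induction rule: rtrancl_induct)
  case (step y z)
  then have "(f y, f z) \<in> adj ((`) f ` E)" by (force simp: adj_def)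
  then show ?case using step.IH by (rule rtrancl_into_rtrancl[rotated])
qed simp

lemma isomorphic_kgraph:
  assumes "kgraph k H" "isomorphic H G"
  shows "kgraph k G"
proof -
  from assms(2) obtain f where f: "bij_betw f (verts H) (verts G)" "(`) f ` edges H = edges G"
    by (auto simp: isomorphic_def)
  have "e \<subseteq> verts G \<and> card e = k" if "e \<in> edges G" for e
  proof -
    from that f(2) obtain e' where e': "e' \<in> edges H" "e = f ` e'" by blast
    then have "e' \<subseteq> verts H" "card e' = k" using assms(1) by (auto simp: kgraph_def)
    then show ?thesis
      using e'(2) f(1) by (auto simp: bij_betw_def card_image inj_on_subset)
  qed
  then show ?thesis
    using assms(1) bij_betw_finite[OF f(1)] by (auto simp: kgraph_def)
qed

lemma isomorphic_sym:
  assumes "kgraph k H" "isomorphic H G"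
  shows "isomorphic G H"
proof -
  from assms(2) obtain f where f: "bij_betw f (verts H) (verts G)" "(`) f ` edges H = edges G"
    by (auto simp: isomorphic_def)
  define g where "g = inv_into (verts H) f"
  have "g ` (f ` e) = e" if "e \<in> edges H" for e
    unfolding g_def using inv_into_image_cancel[of f "verts H" e] f(1) assms(1) that
    by (simp add: bij_betw_def kgraph_def)
  then have "(`) g ` ((`) f ` edges H) = edges H" by (rule image_left_inverse)
  moreover have "bij_betw g (verts G) (verts H)"
    unfolding g_def using f(1) by (rule bij_betw_inv_into)
  ultimately show ?thesis unfolding isomorphic_def f(2) by blast
qed

text \<open>Transfers membership and the largest root between vertex types. Cycles and matchings are
  sets of edges, so injectivity of \<open>f\<close> is lifted to sets twice.\<close>

lemma isomorphic_LCa: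
  assumes "H \<in> LCa k m t" "isomorphic H G"
  shows "G \<in> LCa k m t" "max_root k G = max_root k H"
proof -
  from assms(2) obtain f where f: "bij_betw f (verts H) (verts G)" "(`) f ` edges H = edges G"
    by (auto simp: isomorphic_def)
  define V where "V = verts H"
  define E where "E = edges H"
  have inj: "inj_on f V" and VG: "verts G = f ` V" using f(1) by (auto simp: bij_betw_def V_def)
  have EG: "edges G = (`) f ` E" using f(2) by (simp add: E_def)
  have H: "kgraph k H" "V \<noteq> {}" "\<And>x y. x \<in> V \<Longrightarrow> y \<in> V \<Longrightarrow> (x, y) \<in> (adj E)\<^sup>*"
    "\<And>e f. e \<in> E \<Longrightarrow> f \<in> E \<Longrightarrow> e \<noteq> f \<Longrightarrow> card (e \<inter> f) \<le> 1"
    "\<And>C D. C \<in> cyc E \<Longrightarrow> D \<in> cyc E \<Longrightarrow> C \<noteq> D \<Longrightarrow> card (\<Union>C \<inter> \<Union>D) \<le> 1"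
    "card E = m" "card (cyc E) = t"
    using assms(1) by (auto simp: LCa_iff linear_hypergraph_def E_def V_def)
  have EV: "e \<subseteq> V" if "e \<in> E" for e using H(1) that by (auto simp: kgraph_def E_def V_def)
  then have UV: "\<Union>E \<subseteq> V" by blast
  have inj1: "inj_on ((`) f) (Pow V)" using inj by (rule inj_on_image_Pow)
  then have inj2: "inj_on ((`) ((`) f)) (Pow (Pow V))" by (rule inj_on_image_Pow)
  have Epow: "E \<subseteq> Pow V" using EV by blast
  then have cycpow: "cyc E \<subseteq> Pow (Pow V)" using cyc_subset by blast
  have injE: "inj_on ((`) f) E" by (rule inj_on_subset[OF inj1 Epow])
  have card_cap: "card (f ` a \<inter> f ` b) = card (a \<inter> b)" if "a \<subseteq> V" "b \<subseteq> V" for a b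
  proof -
    have "f ` a \<inter> f ` b = f ` (a \<inter> b)" using inj_on_image_Int[OF inj that] by simp
    moreover have "inj_on f (a \<inter> b)" by (rule inj_on_subset[OF inj]) (use that in blast)
    ultimately show ?thesis by (simp add: card_image)
  qed
  have cycG: "cyc (edges G) = (`) ((`) f) ` cyc E" unfolding EG by (rule cyc_image[OF inj UV])
  show "G \<in> LCa k m t"
    unfolding LCa_iff
  proof (intro conjI ballI impI)
    show "kgraph k G" by (rule isomorphic_kgraph[OF H(1) assms(2)])
    show "verts G \<noteq> {}" using H(2) VG by simp
    show "(x, y) \<in> (adj (edges G))\<^sup>*" if "x \<in> verts G" "y \<in> verts G" for x y
      using that H(3) adj_image[of _ _ E f] unfolding VG EG by blast
    show "linear_hypergraph G"
      unfolding linear_hypergraph_def EG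
    proof (intro ballI impI)
      fix a b assume "a \<in> (`) f ` E" "b \<in> (`) f ` E" "a \<noteq> b"
      then obtain e e' where "e \<in> E" "e' \<in> E" "a = f ` e" "b = f ` e'" "e \<noteq> e'" by blast
      then show "card (a \<inter> b) \<le> 1" using H(4) card_cap[OF EV EV] by simp
    qed
    show "card (\<Union>C \<inter> \<Union>D) \<le> 1" if CD: "C \<in> cyc (edges G)" "D \<in> cyc (edges G)" "C \<noteq> D" for C D
    proof -
      obtain C' D' where "C' \<in> cyc E" "D' \<in> cyc E" "C = (`) f ` C'" "D = (`) f ` D'"
        using CD(1,2) unfolding cycG by blast
      moreover from this have "C' \<noteq> D'" using CD(3) by blast
      moreover have "\<Union>((`) f ` X) = f ` \<Union>X" for X by blast
      moreover have "\<Union>C' \<subseteq> V" "\<Union>D' \<subseteq> V" using calculation(1,2) cyc_subset UV by blast+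
      ultimately show ?thesis using H(5) card_cap by simp
    qed
    show "card (edges G) = m" unfolding EG using card_image[OF injE] H(6) by simp
    show "card (cyc (edges G)) = t"
      unfolding cycG using card_image[OF inj_on_subset[OF inj2 cycpow]] H(7) by simp
  qed
  have "matchings G r = (`) ((`) f) ` matchings H r" for r
  proof -
    have pw: "pairwise disjnt ((`) f ` M) \<longleftrightarrow> pairwise disjnt M" if "M \<subseteq> E" for M
    proof -
      have "f ` a = f ` b \<longleftrightarrow> a = b" "disjnt (f ` a) (f ` b) \<longleftrightarrow> disjnt a b" if "a \<in> M" "b \<in> M" for a b
      proof -
        have ab: "a \<in> E" "b \<in> E" using that \<open>M \<subseteq> E\<close> by auto
        show "f ` a = f ` b \<longleftrightarrow> a = b" by (rule inj_on_eq_iff[OF injE ab])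
        show "disjnt (f ` a) (f ` b) \<longleftrightarrow> disjnt a b"
          using disjnt_image_iff[OF inj EV EV] ab by simp
      qed
      then show ?thesis by (simp add: pairwise_image pairwise_def)
    qed
    have cd: "card ((`) f ` M) = card M" if "M \<subseteq> E" for M
      by (rule card_image[OF inj_on_subset[OF injE that]])
    show ?thesis
    proof (intro equalityI subsetI)
      fix N assume N: "N \<in> matchings G r"
      then obtain M where "M \<subseteq> E" "N = (`) f ` M"
        by (auto simp: matchings_def EG subset_image_iff)
      then show "N \<in> (`) ((`) f) ` matchings H r"
        using N pw cd by (auto simp: matchings_def E_def[symmetric])
    next
      fix N assume "N \<in> (`) ((`) f) ` matchings H r"
      then show "N \<in> matchings G r"
        using pw cd by (auto simp: matchings_def EG E_def[symmetric])
    qed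
  qed
  moreover have "matchings H r \<subseteq> Pow (Pow V)" for r using Epow by (auto simp: matchings_def E_def)
  ultimately have "card (matchings G r) = card (matchings H r)" for r
    using card_image[OF inj_on_subset[OF inj2]] by metis
  moreover have "card (edges G) = card (edges H)" "card (verts G) = card (verts H)"
    using card_image[OF injE] card_image[OF inj] unfolding EG VG E_def V_def by auto
  ultimately have "matching_poly k G = matching_poly k H" by (simp add: matching_poly_def)
  then show "max_root k G = max_root k H" by (simp add: max_root_def)
qed

text \<open>Needed because \<open>maximizing\<close> compares hypergraphs over one vertex type, and
  \<open>L_graph\<close> lives over \<open>Lvertex\<close>.\<close>

lemma isomorphic_copy:
  fixes H :: "'b hypergraph"
  assumes "finite (verts H)" "infinite (UNIV :: 'a set)"
  obtains G :: "'a hypergraph" where "isomorphic H G"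
proof -
  obtain T :: "'a set" where T: "finite T" "card T = card (verts H)"
    using infinite_arbitrarily_large[OF assms(2)] by blast
  then obtain f where "bij_betw f (verts H) T"
    using finite_same_card_bij[OF assms(1)] by metis
  then have "isomorphic H (Hypergraph T ((`) f ` edges H))"
    by (auto simp: isomorphic_def)
  then show thesis by (rule that)
qed

section \<open>The extremal cactus\<close>

text \<open>If \<open>r\<close> is among the vertices of the sequence, it is rotated to index 0.
  From \<open>e 0\<close> on, consecutive edges then share a vertex other than \<open>r\<close> and
  stay in the same part.\<close>

lemma cycle_in_one_part:
  assumes "D \<in> cyc E" "E \<subseteq> A \<union> B" "\<Union>A \<inter> \<Union>B \<subseteq> {r}"
  shows "D \<subseteq> A \<or> D \<subseteq> B"
proof -
  obtain n v0 e0 where c0: "fcycle E n v0 e0" "D = e0 ` {..<n}" using assms(1) by (rule cycE)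
  obtain v e where c: "fcycle E n v e" "D = e ` {..<n}" and r: "\<And>i. 0 < i \<Longrightarrow> i < n \<Longrightarrow> v i \<noteq> r"
  proof (cases "\<exists>p<n. v0 p = r")
    case True
    then obtain p where p: "p < n" "v0 p = r" by blast
    define v where "v = (\<lambda>i. v0 ((i + p) mod n))"
    define e where "e = (\<lambda>i. e0 ((i + p) mod n))"
    have c: "fcycle E n v e" "D = e ` {..<n}"
      using fcycle_shift[OF c0(1), of p] c0(2) by (auto simp: v_def e_def)
    have "v 0 = r" using p by (simp add: v_def)
    then have "v i \<noteq> r" if "0 < i" "i < n" for i
      using fcycle_inj(2)[OF c(1), of i 0] that by auto
    then show ?thesis using that[OF c] by blast
  next
    case False
    then show ?thesis using that[OF c0] by blast
  qed
  have part: "e i \<in> X" if "X \<union> Y = A \<union> B" "\<Union>X \<inter> \<Union>Y \<subseteq> {r}" "e 0 \<in> X" "i < n" for X Y i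
    using that(4)
  proof (induction i)
    case (Suc i)
    have "e i \<in> X" "v (Suc i) \<in> e i" "v (Suc i) \<in> e (Suc i)" "v (Suc i) \<noteq> r"
      using Suc fcycleD(4,5)[OF c(1)] r by auto
    moreover have "e (Suc i) \<in> X \<union> Y" using fcycleD(3)[OF c(1) Suc.prems] assms(2) that(1) by blast
    ultimately show ?case using that(2) by blast
  qed (rule that(3))
  have "0 < n" using fcycleD(2)[OF c(1)] by simp
  then have "e 0 \<in> A \<or> e 0 \<in> B" using fcycleD(3)[OF c(1)] assms(2) by blast
  then show ?thesis
  proof
    assume "e 0 \<in> A"
    then show ?thesis using part[of A B] assms(3) c(2) by auto
  next
    assume "e 0 \<in> B"
    then show ?thesis using part[of B A] assms(3) c(2) by (auto simp: Un_commute Int_commute)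
  qed
qed

text \<open>The edges \<open>g\<^bsub>i,1\<^esub>\<close>, \<open>g\<^bsub>i,2\<^esub>\<close>, \<open>g\<^bsub>i,3\<^esub>\<close> of the \<open>i\<close>-th cycle; only \<open>g\<^bsub>i,2\<^esub>\<close> avoids the centre.\<close>

definition rim1 :: "nat \<Rightarrow> nat \<Rightarrow> Lvertex set" where
  "rim1 k i = {VertU, VertA i} \<union> CycleLeaf i 1 ` {..<k - 2}"
definition rim2 :: "nat \<Rightarrow> nat \<Rightarrow> Lvertex set" where
  "rim2 k i = {VertA i, VertB i} \<union> CycleLeaf i 2 ` {..<k - 2}"
definition rim3 :: "nat \<Rightarrow> nat \<Rightarrow> Lvertex set" where
  "rim3 k i = {VertB i, VertU} \<union> CycleLeaf i 3 ` {..<k - 2}"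
definition pendant :: "nat \<Rightarrow> nat \<Rightarrow> Lvertex set" where
  "pendant k i = {VertU} \<union> PendantLeaf i ` {..<k - 1}"

lemmas L_defs = rim1_def rim2_def rim3_def pendant_def

lemma L_cycle_rims: "L_cycle k i = {rim1 k i, rim2 k i, rim3 k i}"
  by (simp add: L_cycle_def L_defs)

lemma L_edges_cases:
  assumes "e \<in> L_edges k m t"
  obtains i where "i < t" "e = rim1 k i" | i where "i < t" "e = rim2 k i"
    | i where "i < t" "e = rim3 k i" | i where "i < m - 3 * t" "e = pendant k i"
proof -
  from assms consider "\<exists>i<t. e = rim1 k i \<or> e = rim2 k i \<or> e = rim3 k i" | "\<exists>i<m - 3 * t. e = pendant k i"
    unfolding L_edges_def L_cycle_rims pendant_def[symmetric] by blast
  then show thesis by cases (use that in blast)+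
qed

lemma L_edges_eq:
  "L_edges k m t = rim2 k ` {..<t} \<union> (rim1 k ` {..<t} \<union> rim3 k ` {..<t} \<union> pendant k ` {..<m - 3 * t})"
  unfolding L_edges_def L_cycle_rims pendant_def[symmetric] by auto

lemma edges_L_graph [simp]: "edges (L_graph k m t) = L_edges k m t"
  by (simp add: L_graph_def)

lemma finite_L_edges: "finite (L_edges k m t)"
  by (simp add: L_edges_eq)

lemma VertU_L [simp]: "VertU \<in> rim1 k i" "VertU \<notin> rim2 k i" "VertU \<in> rim3 k i" "VertU \<in> pendant k i"
  by (auto simp: L_defs)

lemma VertA_L [simp]: "VertA j \<in> rim1 k i \<longleftrightarrow> j = i" "VertA j \<in> rim2 k i \<longleftrightarrow> j = i"
  "VertA j \<notin> rim3 k i" "VertA j \<notin> pendant k i"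
  by (auto simp: L_defs)

lemma VertB_L [simp]: "VertB j \<notin> rim1 k i" "VertB j \<in> rim2 k i \<longleftrightarrow> j = i"
  "VertB j \<in> rim3 k i \<longleftrightarrow> j = i" "VertB j \<notin> pendant k i"
  by (auto simp: L_defs)

lemma L_distinct [simp]: "rim1 k i \<noteq> rim2 k j" "rim1 k i \<noteq> rim3 k j" "rim2 k i \<noteq> rim3 k j"
  "rim1 k i \<noteq> pendant k j" "rim2 k i \<noteq> pendant k j" "rim3 k i \<noteq> pendant k j"
  using VertU_L VertA_L VertB_L by metis+

lemma inj_L: "inj (rim1 k)" "inj (rim2 k)" "inj (rim3 k)" "2 \<le> k \<Longrightarrow> inj (pendant k)"
proof -
  show "inj (rim1 k)" "inj (rim2 k)" "inj (rim3 k)"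
    using VertA_L(1,2) VertB_L(3) by (metis injI)+
  assume k: "2 \<le> k"
  show "inj (pendant k)"
  proof (rule injI)
    fix i j assume "pendant k i = pendant k j"
    moreover have "PendantLeaf i 0 \<in> pendant k i" using k by (auto simp: pendant_def)
    ultimately show "i = j" by (auto simp: pendant_def)
  qed
qed

lemma card_L:
  assumes "2 \<le> k"
  shows "card (rim1 k i) = k" "card (rim2 k i) = k" "card (rim3 k i) = k" "card (pendant k i) = k"
proof -
  have c: "card (CycleLeaf i j ` {..<k - 2}) = k - 2" for j
    by (simp add: card_image inj_on_def)
  have p: "card (PendantLeaf i ` {..<k - 1}) = k - 1"
    by (simp add: card_image inj_on_def)
  have u: "card (A \<union> CycleLeaf i j ` {..<k - 2}) = k"
    if "card A = 2" "A \<inter> range (CycleLeaf i j) = {}" for A j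
  proof -
    have "finite A" using that(1) by (auto intro: card_ge_0_finite)
    then have "card (A \<union> CycleLeaf i j ` {..<k - 2}) = card A + card (CycleLeaf i j ` {..<k - 2})"
      using that(2) by (intro card_Un_disjoint) auto
    then show ?thesis using that(1) c assms by simp
  qed
  show "card (rim1 k i) = k" "card (rim2 k i) = k" "card (rim3 k i) = k"
    unfolding L_defs by (rule u; auto)+
  have "VertU \<notin> PendantLeaf i ` {..<k - 1}" by auto
  then show "card (pendant k i) = k" using p assms unfolding pendant_def by simp
qed

lemma card_image_lessThan: "inj f \<Longrightarrow> card (f ` {..<n}) = n" for n :: nat
  by (simp add: card_image inj_on_subset)

lemma card_L_edges:
  assumes "2 \<le> k" "3 * t \<le> m"
  shows "card (L_edges k m t) = m"
proof -
  note cards = inj_L(1-3)[THEN card_image_lessThan] inj_L(4)[OF assms(1), THEN card_image_lessThan]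
  have "card (L_edges k m t) = card (rim2 k ` {..<t}) +
      (card (rim1 k ` {..<t}) + card (rim3 k ` {..<t}) + card (pendant k ` {..<m - 3 * t}))"
    unfolding L_edges_eq
    by (subst card_Un_disjoint; (force simp: L_distinct[symmetric])?)+
  then show ?thesis using assms(2) by (simp add: cards)
qed

lemma L_linear_system:
  assumes "2 \<le> k"
  shows "linear_system (L_edges k m t)"
proof
  show "finite (L_edges k m t)" by (rule finite_L_edges)
  show "2 \<le> card e" if "e \<in> L_edges k m t" for e
    using that assms by (auto elim!: L_edges_cases simp: card_L)
  show "card (e \<inter> f) \<le> 1" if "e \<in> L_edges k m t" "f \<in> L_edges k m t" "e \<noteq> f" for e f
  proof -
    have "\<exists>x. e \<inter> f \<subseteq> {x}"
      by (rule L_edges_cases[OF that(1)]; rule L_edges_cases[OF that(2)])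
        (use that(3) in \<open>auto simp: L_defs\<close>)
    then obtain x where "e \<inter> f \<subseteq> {x}" by blast
    from card_mono[OF _ this] show ?thesis by simp
  qed
qed

lemma L_cycle_in_cyc:
  assumes "i < t"
  shows "L_cycle k i \<in> cyc (L_edges k m t)"
proof -
  define v where "v j = (if j = 1 then VertA i else if j = 2 then VertB i else VertU)" for j :: nat
  define e where "e j = (if j = 0 then rim1 k i else if j = 1 then rim2 k i else rim3 k i)" for j :: nat
  have 3: "{..<3::nat} = {0, 1, 2}" by auto
  have "fcycle (L_edges k m t) 3 v e"
    using assms unfolding fcycle_def All_less_Suc numeral_3_eq_3 L_edges_eq
    by (auto simp: inj_on_def v_def e_def L_defs less_Suc_eq)
  then have "e ` {..<3} \<in> cyc (L_edges k m t)" by (rule cycI)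
  moreover have "e ` {..<3} = L_cycle k i" by (auto simp: 3 e_def L_cycle_rims)
  ultimately show ?thesis by simp
qed

text \<open>Every triangle and every pendant edge meets the rest at \<open>VertU\<close> only, so a
  cycle lies inside it or misses it. Having at least three edges, a cycle must be one of the
  triangles.\<close>

lemma cyc_L_edges:
  assumes "2 \<le> k"
  shows "cyc (L_edges k m t) = L_cycle k ` {..<t}"
proof (intro equalityI subsetI)
  interpret linear_system "L_edges k m t" by (rule L_linear_system[OF assms])
  fix D assume D: "D \<in> cyc (L_edges k m t)"
  from D obtain n v e where "fcycle (L_edges k m t) n v e" "D = e ` {..<n}" by (rule cycE)
  then have card3: "card D \<ge> 3"
    using fcycle_length[of n v e] by (auto simp: fcycle_def card_image)
  show "D \<in> L_cycle k ` {..<t}"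
  proof (rule ccontr)
    assume no: "D \<notin> L_cycle k ` {..<t}"
    have split: "D \<subseteq> A \<or> D \<inter> A = {}" if "A \<subseteq> L_edges k m t"
      "\<Union>A \<inter> \<Union>(L_edges k m t - A) \<subseteq> {VertU}" for A
      using cycle_in_one_part[OF D, of A "L_edges k m t - A"] that by blast
    have rims: "D \<inter> L_cycle k i = {}" if "i < t" for i
    proof -
      have "\<Union>(L_cycle k i) \<inter> e \<subseteq> {VertU}" if "e \<in> L_edges k m t" "e \<notin> L_cycle k i" for e
        using that(1) by (rule L_edges_cases) (use that(2) in \<open>auto simp: L_cycle_rims L_defs\<close>)
      then have "\<Union>(L_cycle k i) \<inter> \<Union>(L_edges k m t - L_cycle k i) \<subseteq> {VertU}" by blast
      moreover have "L_cycle k i \<subseteq> L_edges k m t" using that by (auto simp: L_edges_def)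
      moreover have "\<not> D \<subseteq> L_cycle k i"
      proof
        assume sub: "D \<subseteq> L_cycle k i"
        have "card (L_cycle k i) \<le> 3" by (simp add: L_cycle_rims card_insert_if)
        then have "D = L_cycle k i"
          using card_seteq[OF _ sub] card3 by (simp add: L_cycle_rims)
        then show False using no that by blast
      qed
      ultimately show ?thesis using split by blast
    qed
    have pend: "pendant k i \<notin> D" if "i < m - 3 * t" for i
    proof -
      have "pendant k i \<inter> e \<subseteq> {VertU}" if "e \<in> L_edges k m t" "e \<noteq> pendant k i" for e
        using that(1) by (rule L_edges_cases) (use that(2) in \<open>auto simp: L_defs\<close>)
      then have "\<Union>{pendant k i} \<inter> \<Union>(L_edges k m t - {pendant k i}) \<subseteq> {VertU}" by blast
      moreover have "{pendant k i} \<subseteq> L_edges k m t" using that by (auto simp: L_edges_eq)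
      moreover have "\<not> D \<subseteq> {pendant k i}"
        using card_mono[of "{pendant k i}" D] card3 by auto
      ultimately show ?thesis using split[of "{pendant k i}"] by blast
    qed
    have "D \<noteq> {}" using card3 by auto
    then obtain d where "d \<in> D" "d \<in> L_edges k m t" using cyc_subset[OF D] by blast
    from this(2) show False
      by (rule L_edges_cases) (use \<open>d \<in> D\<close> rims pend in \<open>auto simp: L_cycle_rims\<close>)
  qed
qed (use L_cycle_in_cyc in blast)

lemma L_graph_LCa:
  assumes "2 \<le> k" "3 * t \<le> m"
  shows "L_graph k m t \<in> LCa k m t"
  unfolding LCa_iff edges_L_graph
proof (intro conjI ballI impI)
  let ?E = "L_edges k m t"
  interpret linear_system ?E by (rule L_linear_system[OF assms(1)])
  have "finite e \<and> card e = k" if "e \<in> ?E" for e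
    using that assms(1) by (auto elim!: L_edges_cases simp: card_L) (auto simp: L_defs)
  then show "kgraph k (L_graph k m t)"
    using finite_L_edges by (auto simp: kgraph_def L_graph_def)
  show "verts (L_graph k m t) \<noteq> {}" by (simp add: L_graph_def)
  have U: "(VertU, x) \<in> (adj ?E)\<^sup>*" if x: "x \<in> verts (L_graph k m t)" for x
  proof (cases "x = VertU")
    case False
    then obtain e where e: "x \<in> e" "e \<in> ?E" using x by (auto simp: L_graph_def)
    show ?thesis
    proof (cases "VertU \<in> e")
      case True
      then show ?thesis using e by (intro r_into_rtrancl) (auto simp: adj_def)
    next
      case False
      then obtain i where i: "i < t" "e = rim2 k i" using e(2) by (auto elim: L_edges_cases)
      then have "rim1 k i \<in> ?E" by (auto simp: L_edges_eq)
      moreover have "VertA i \<in> rim1 k i" "VertA i \<in> rim2 k i" by (auto simp: L_defs)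
      ultimately have "(VertU, VertA i) \<in> adj ?E" "(VertA i, x) \<in> adj ?E"
        using e i VertU_L(1) unfolding adj_def by blast+
      then show ?thesis by (meson r_into_rtrancl rtrancl_trans)
    qed
  qed simp
  show "(x, y) \<in> (adj ?E)\<^sup>*" if "x \<in> verts (L_graph k m t)" "y \<in> verts (L_graph k m t)" for x y
    using adj_sym[OF U[OF that(1)]] U[OF that(2)] by (rule rtrancl_trans)
  show "linear_hypergraph (L_graph k m t)"
    using linear by (auto simp: linear_hypergraph_def)
  show "card (\<Union>C \<inter> \<Union>D) \<le> 1" if CD: "C \<in> cyc ?E" "D \<in> cyc ?E" "C \<noteq> D" for C D
  proof -
    obtain i j where ij: "C = L_cycle k i" "D = L_cycle k j" "i \<noteq> j"
      using CD unfolding cyc_L_edges[OF assms(1)] by blast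
    then have "\<Union>C \<inter> \<Union>D \<subseteq> {VertU}" by (auto simp: L_cycle_rims L_defs)
    from card_mono[OF _ this] show ?thesis by simp
  qed
  show "card ?E = m" by (rule card_L_edges[OF assms])
  have "inj (L_cycle k)"
  proof (rule injI)
    fix i j assume "L_cycle k i = L_cycle k j"
    moreover have "VertA i \<in> \<Union>(L_cycle k i)" by (auto simp: L_cycle_rims L_defs)
    ultimately show "i = j" by (auto simp: L_cycle_rims L_defs)
  qed
  then show "card (cyc ?E) = t"
    unfolding cyc_L_edges[OF assms(1)] by (simp add: card_image inj_on_subset)
qed

text \<open>Expansion at \<open>VertU\<close>: the edges missing it are the \<open>t\<close>
  disjoint \<open>rim2\<close> edges, of which \<open>rim1 k i\<close> and \<open>rim3 k i\<close>
  meet just \<open>rim2 k i\<close> and a pendant edge meets none. For \<open>t = 0\<close> the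
  truncated exponent \<open>t - 1\<close> occurs with factor 0.\<close>

lemma mgen_L_edges:
  assumes "2 \<le> k" "3 * t \<le> m"
  shows "mgen (L_edges k m t) w = (1 - w) ^ t - 2 * of_nat t * w * (1 - w) ^ (t - 1)
    - of_nat (m - 3 * t) * w * (1 - w) ^ t"
proof -
  define S where "S = rim2 k ` {..<t}"
  define X where "X = rim1 k ` {..<t} \<union> rim3 k ` {..<t} \<union> pendant k ` {..<m - 3 * t}"
  have S: "{e \<in> L_edges k m t. VertU \<notin> e} = S" and X: "{e \<in> L_edges k m t. VertU \<in> e} = X"
    by (auto simp: L_edges_eq S_def X_def)
  have cS: "card S = t" unfolding S_def by (rule card_image_lessThan[OF inj_L(2)])
  have pw: "pairwise disjnt S"
    unfolding S_def pairwise_def by (auto simp: disjnt_def L_defs)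
  have val: "mgen (away S e) w = (1 - w) ^ card (away S e)" for e
    by (intro mgen_matching) (use pw in \<open>auto simp: away_def S_def pairwise_def\<close>)
  have 1: "away S (rim1 k i) = S - {rim2 k i}" if "i < t" for i
    using that by (auto simp: away_def S_def disjnt_iff L_defs)
  have 3: "away S (rim3 k i) = S - {rim2 k i}" if "i < t" for i
    using that by (auto simp: away_def S_def disjnt_iff L_defs)
  have p: "away S (pendant k i) = S" for i
    by (auto simp: away_def S_def disjnt_iff L_defs)
  have c: "card (S - {rim2 k i}) = t - 1" if "i < t" for i
    using that cS by (subst card_Diff_singleton) (auto simp: S_def)
  have "(\<Sum>e\<in>X. mgen (away S e) w) = (\<Sum>e\<in>rim1 k ` {..<t}. mgen (away S e) w)
      + (\<Sum>e\<in>rim3 k ` {..<t}. mgen (away S e) w) + (\<Sum>e\<in>pendant k ` {..<m - 3 * t}. mgen (away S e) w)"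
    unfolding X_def by (subst sum.union_disjoint; (force simp: L_distinct[symmetric])?)+
  also have "(\<Sum>e\<in>rim1 k ` {..<t}. mgen (away S e) w) = (\<Sum>i<t. (1 - w) ^ (t - 1))"
    by (subst sum.reindex) (auto intro!: sum.cong inj_on_subset[OF inj_L(1)] simp: val 1 c)
  also have "(\<Sum>e\<in>rim3 k ` {..<t}. mgen (away S e) w) = (\<Sum>i<t. (1 - w) ^ (t - 1))"
    by (subst sum.reindex) (auto intro!: sum.cong inj_on_subset[OF inj_L(3)] simp: val 3 c)
  also have "(\<Sum>e\<in>pendant k ` {..<m - 3 * t}. mgen (away S e) w) = (\<Sum>i<m - 3 * t. (1 - w) ^ t)"
    by (subst sum.reindex)
      (auto intro!: sum.cong inj_on_subset[OF inj_L(4)[OF assms(1)]] simp: val p cS)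
  finally have "(\<Sum>e\<in>X. mgen (away S e) w) =
      2 * of_nat t * (1 - w) ^ (t - 1) + of_nat (m - 3 * t) * (1 - w) ^ t" by simp
  moreover have "mgen S w = (1 - w) ^ t"
    using mgen_matching[OF _ pw, of w] cS by (simp add: S_def)
  ultimately show ?thesis
    using mgen_vertex_expansion[OF finite_L_edges[of k m t], of w VertU] unfolding S X
    by (simp add: algebra_simps)
qed

text \<open>Clearing the denominator gives a polynomial with value 1 at 0 and \<open>- 2 * t\<close>
  at 1, to which the intermediate value theorem applies; for \<open>t = 0\<close> the zero is
  \<open>1 / m\<close>, below 1 because \<open>m\<close> is at least 2.\<close>

lemma gap_root:
  assumes "3 * t \<le> m" "2 \<le> m"
  obtains \<beta> where "0 < \<beta>" "\<beta> < 1" "gap \<beta> m t = 0" "\<forall>z\<in>{0<..<\<beta>}. 0 < gap z m t"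
proof -
  obtain \<beta> where b: "0 < \<beta>" "\<beta> < 1" "gap \<beta> m t = 0"
  proof (cases "t = 0")
    case True
    then show ?thesis using assms(2) by (intro that[of "1 / m"]) (auto simp: gap_def field_simps)
  next
    case False
    define h where "h z = (1 - z) * (1 - (real m - 3 * real t) * z) - 2 * real t * z" for z
    have "\<exists>z\<ge>0. z \<le> 1 \<and> h z = 0"
    proof (rule IVT2')
      show "continuous_on {0..1} h" unfolding h_def by (intro continuous_intros)
    qed (use False in \<open>auto simp: h_def\<close>)
    then obtain z where z: "0 \<le> z" "z \<le> 1" "h z = 0" by blast
    have "z \<noteq> 0" "z \<noteq> 1" using z(3) False by (auto simp: h_def)
    moreover have "gap z m t = h z / (1 - z)" using \<open>z \<noteq> 1\<close> by (simp add: gap_def h_def field_simps)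
    ultimately show ?thesis using z by (intro that[of z]) auto
  qed
  have "0 < gap z m t" if z: "0 < z" "z < \<beta>" for z
  proof -
    have "1 - z \<noteq> 0" "1 - \<beta> \<noteq> 0" using b(2) z by auto
    then have "\<beta> / (1 - \<beta>) - z / (1 - z) = (\<beta> - z) / ((1 - \<beta>) * (1 - z))"
      by (simp add: divide_simps) (simp add: algebra_simps)
    moreover have "gap z m t - gap \<beta> m t = (real m - 3 * real t) * (\<beta> - z)
        + 2 * real t * (\<beta> / (1 - \<beta>) - z / (1 - z))"
      by (simp add: gap_def algebra_simps)
    \<comment> \<open>Both coefficients of \<open>\<beta> - z\<close> are nonnegative and at least
      one is positive, so \<open>gap\<close> exceeds its value 0 at \<beta>.\<close>
    ultimately have *: "gap z m t = (real m - 3 * real t) * (\<beta> - z)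
        + 2 * real t * (\<beta> - z) / ((1 - \<beta>) * (1 - z))"
      using b(3) by simp
    have m: "real m - 3 * real t \<ge> 0" using assms(1) by linarith
    show ?thesis
    proof (cases "t = 0")
      case True
      then show ?thesis unfolding * using z assms by simp
    next
      case False
      then have "2 * real t * (\<beta> - z) / ((1 - \<beta>) * (1 - z)) > 0" using b z by simp
      moreover have "(real m - 3 * real t) * (\<beta> - z) \<ge> 0" using m z by simp
      ultimately show ?thesis unfolding * by linarith
    qed
  qed
  then show thesis using that[OF b] by auto
qed

lemma mgen_L_edges_gap:
  assumes "2 \<le> k" "3 * t \<le> m" "z < 1"
  shows "mgen (L_edges k m t) z = (1 - z) ^ t * gap z m t"
proof (cases t)
  case 0
  then show ?thesis using assms by (simp add: mgen_L_edges gap_def)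
next
  case (Suc s)
  then have "real (m - 3 * t) = real m - 3 * real t" using assms(2) by (simp add: of_nat_diff)
  moreover have "(1 - z) ^ t = (1 - z) * (1 - z) ^ (t - 1)" using Suc by simp
  ultimately show ?thesis
    using assms(3) unfolding mgen_L_edges[OF assms(1,2)] gap_def
    by (simp add: divide_simps) (simp add: algebra_simps)
qed

section \<open>Comparison of the largest roots\<close>

lemma LCa_bound:
  assumes "2 \<le> k" "H \<in> LCa k m t" "0 < z" "z < 1" "0 \<le> gap z m t"
  shows "mgen (edges H) z \<ge> (1 - z) ^ t * gap z m t"
    and "(\<And>u. t < card {e \<in> edges H. u \<notin> e}) \<Longrightarrow> mgen (edges H) z > (1 - z) ^ t * gap z m t"
    and "mgen (edges H) z > 0 \<Longrightarrow> cmod w \<le> z \<Longrightarrow> mgen (edges H) w \<noteq> 0"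
proof -
  have m: "card (edges H) = m" using assms(2) by (simp add: LCa_iff)
  note g = LCa_glued[OF assms(1,2)]
  note b = glued_bound[OF g assms(3,4), unfolded m, OF assms(5)]
  show "mgen (edges H) z \<ge> (1 - z) ^ t * gap z m t" using b by blast
  show "mgen (edges H) z > (1 - z) ^ t * gap z m t" if "\<And>u. t < card {e \<in> edges H. u \<notin> e}"
    using b that by blast
  show "mgen (edges H) w \<noteq> 0" if "mgen (edges H) z > 0" "cmod w \<le> z"
  proof -
    have "good (edges H) z" using b that(1) by blast
    from mgen_nonzero[OF glued_finite[OF g] this assms(3) that(2)] show ?thesis .
  qed
qed

text \<open>For the weak inequality every radius below \<beta> is covered by a point where
  \<open>gap\<close> is positive. For the strict one the bound is applied at \<beta>, where
  \<open>gap\<close> vanishes: strictness of the bound gives positivity there and with it a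
  zero-free closed disc.\<close>

theorem max_root_comparison:
  fixes H :: "'a hypergraph"
  assumes "2 \<le> k" "2 \<le> m" "3 * t \<le> m" "H \<in> LCa k m t"
  shows "max_root k H \<le> max_root k (L_graph k m t)"
    and "(\<And>u. t < card {e \<in> edges H. u \<notin> e}) \<Longrightarrow> max_root k H < max_root k (L_graph k m t)"
proof -
  obtain \<beta> where b: "0 < \<beta>" "\<beta> < 1" "gap \<beta> m t = 0" "\<forall>z\<in>{0<..<\<beta>}. 0 < gap z m t"
    using gap_root[OF assms(3,2)] .
  have H: "kgraph k H" "verts H \<noteq> {}" using assms(4) by (auto simp: LCa_iff)
  have L: "kgraph k (L_graph k m t)" "verts (L_graph k m t) \<noteq> {}"
    using L_graph_LCa[OF assms(1,3)] by (auto simp: LCa_iff)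
  have ge: "root k (1 / \<beta>) \<le> max_root k (L_graph k m t)"
    using max_root_ge[OF L(1) assms(1) L(2) b(1)] mgen_L_edges_gap[OF assms(1,3) b(2)] b(3) by simp
  have "max_root k H \<le> root k (1 / \<beta>)"
  proof (rule max_root_le[OF H(1) assms(1) H(2) b(1)])
    fix w :: complex assume w: "cmod w < \<beta>"
    \<comment> \<open>The midpoint is positive even for \<open>w = 0\<close> and still lies below
      \<beta>.\<close>
    define z where "z = (cmod w + \<beta>) / 2"
    have "0 < cmod w + \<beta>" using b(1) norm_ge_zero[of w] by linarith
    then have z: "0 < z" "z < \<beta>" "z < 1" "cmod w \<le> z" using w b(2) unfolding z_def by auto
    have g: "0 < gap z m t" using b(4) z by simp
    then have "0 < (1 - z) ^ t * gap z m t" using z by simp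
    then have "mgen (edges H) z > 0"
      using LCa_bound(1)[OF assms(1,4) z(1,3)] g by fastforce
    then show "mgen (edges H) w \<noteq> 0"
      using LCa_bound(3)[OF assms(1,4) z(1,3)] g z(4) by simp
  qed
  then show "max_root k H \<le> max_root k (L_graph k m t)" using ge by simp
  assume "\<And>u. t < card {e \<in> edges H. u \<notin> e}"
  then have "mgen (edges H) \<beta> > 0"
    using LCa_bound(2)[OF assms(1,4) b(1,2)] b(3) by simp
  then have "max_root k H < root k (1 / \<beta>)"
    using LCa_bound(3)[OF assms(1,4) b(1,2)] b(3) by (intro max_root_less[OF H(1) assms(1) H(2) b(1)]) simp
  then show "max_root k H < max_root k (L_graph k m t)" using ge by simp
qed

section \<open>Recognizing the extremal cactus\<close>

lemma enumerate_finite: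
  assumes "finite X" "card X = n"
  shows "\<exists>h :: nat \<Rightarrow> 'a. h ` {..<n} = X"
proof -
  from ex_bij_betw_nat_finite[OF assms(1)] obtain h where "bij_betw h {0..<card X} X" by blast
  then have "h ` {..<n} = X" using assms(2) by (simp add: bij_betw_def atLeast0LessThan)
  then show ?thesis by blast
qed

context linear_cactus
begin

text \<open>In a longer cycle the two neighbours of \<open>c\<close> would be disjoint by
  \<open>chordless\<close>, but both contain \<open>u\<close>. The vertices \<alpha> and \<beta> are
  those at which the cycle enters and leaves \<open>c\<close>.\<close>

lemma triangle_through:
  assumes "C \<in> cyc E" "c \<in> C" "u \<notin> c" "\<forall>e\<in>C - {c}. u \<in> e"
  obtains a b \<alpha> \<beta> where "C = {a, c, b}" "a \<noteq> c" "a \<noteq> b" "b \<noteq> c" "u \<in> a" "u \<in> b"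
    "\<alpha> \<in> a" "\<alpha> \<in> c" "\<beta> \<in> c" "\<beta> \<in> b" "\<alpha> \<noteq> \<beta>"
proof -
  obtain n v0 e0 where c0: "fcycle E n v0 e0" "C = e0 ` {..<n}" using assms(1) by (rule cycE)
  obtain p where p: "p < n" "c = e0 p" using assms(2) c0(2) by auto
  \<comment> \<open>Adding \<open>n - 1\<close> subtracts 1 modulo \<open>n\<close>, which places
    \<open>c = e0 p\<close> at index 1, between \<open>e 0\<close> and \<open>e 2\<close>.\<close>
  define v where "v = (\<lambda>i. v0 ((i + (p + (n - 1))) mod n))"
  define e where "e = (\<lambda>i. e0 ((i + (p + (n - 1))) mod n))"
  have cy: "fcycle E n v e" "C = e ` {..<n}"
    using fcycle_shift[OF c0(1), of "p + (n - 1)"] c0(2) by (auto simp: v_def e_def)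
  have n: "3 \<le> n" using cy(1) by (rule fcycle_length)
  have "1 + (p + (n - 1)) = p + n" using n by simp
  then have e1: "e 1 = c" using p by (simp add: e_def)
  have u: "u \<in> e i" if "i < n" "i \<noteq> 1" for i
    using bspec[OF assms(4), of "e i"] fcycle_inj(1)[OF cy(1), of i 1] cy(2) e1 that n by auto
  have "n = 3"
  proof (rule ccontr)
    assume "n \<noteq> 3"
    then have "disjnt (e 0) (e 2)" using chordless[OF cy(1), of 2] n by simp
    then show False using u[of 0] u[of 2] n by (auto simp: disjnt_iff)
  qed
  have "{..<3::nat} = {0, 1, 2}" by auto
  then have "C = {e 0, c, e 2}" using cy(2) e1 \<open>n = 3\<close> by simp
  moreover have "e 0 \<noteq> c" "e 0 \<noteq> e 2" "e 2 \<noteq> c" "v 1 \<noteq> v 2"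
    using fcycle_inj[OF cy(1), of 0 1] fcycle_inj[OF cy(1), of 0 2] fcycle_inj[OF cy(1), of 1 2] n e1
    by auto
  moreover have "u \<in> e 0" "u \<in> e 2" using u[of 0] u[of 2] n by auto
  moreover have "v 1 \<in> e 0" "v 1 \<in> c" "v 2 \<in> c" "v 2 \<in> e 2"
    using fcycleD(4)[OF cy(1), of 1] fcycleD(4)[OF cy(1), of 2]
      fcycleD(5)[OF cy(1), of 0] fcycleD(5)[OF cy(1), of 1] n e1 by (auto simp: numeral_2_eq_2)
  ultimately show thesis by (intro that[of "e 0" "e 2" "v 1" "v 2"])
qed

text \<open>Each cycle has an edge avoiding \<open>u\<close>, and different cycles have different
  ones, so the count leaves no further edge avoiding \<open>u\<close>. Thus each cycle has exactly
  one.\<close>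

lemma centre_opposite_edges:
  assumes "card {e \<in> E. u \<notin> e} \<le> card (cyc E)"
  obtains c where "\<And>C. C \<in> cyc E \<Longrightarrow> c C \<in> C" "\<And>C. C \<in> cyc E \<Longrightarrow> u \<notin> c C"
    "\<And>e. e \<in> E \<Longrightarrow> u \<notin> e \<Longrightarrow> \<exists>C\<in>cyc E. e = c C"
    "\<And>C. C \<in> cyc E \<Longrightarrow> \<forall>e\<in>C - {c C}. u \<in> e"
proof -
  have "\<exists>c. c \<in> C \<and> u \<notin> c" if "C \<in> cyc E" for C
    using ringlike_avoid[OF cyc_ringlike[OF that], of u] by blast
  then obtain c where c: "c C \<in> C" "u \<notin> c C" if "C \<in> cyc E" for C by metis
  have inj: "inj_on c (cyc E)" using c(1) cyc_eq by (metis inj_onI)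
  have sub: "c ` cyc E \<subseteq> {e \<in> E. u \<notin> e}" using c cyc_subset by blast
  have "c ` cyc E = {e \<in> E. u \<notin> e}"
    by (rule card_seteq[OF _ sub]) (use fin assms card_image[OF inj] in auto)
  then have all: "\<exists>C\<in>cyc E. e = c C" if "e \<in> E" "u \<notin> e" for e using that by blast
  have "u \<in> e" if "C \<in> cyc E" "e \<in> C" "e \<noteq> c C" for C e
  proof (rule ccontr)
    assume "u \<notin> e"
    moreover have "e \<in> E" using that cyc_subset by blast
    ultimately obtain D where D: "D \<in> cyc E" "e = c D" using all by blast
    then have "C = D" using cyc_eq[OF that(1) D(1) that(2)] c(1)[OF D(1)] by simp
    then show False using D that by simp
  qed
  then have "\<forall>e\<in>C - {c C}. u \<in> e" if "C \<in> cyc E" for C using that by blast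
  then show thesis by (intro that[of c] c all)
qed

text \<open>A common vertex \<open>x\<close> of \<open>c\<close> and \<open>f\<close> differs from
  \<open>u\<close>. If \<open>f\<close> lies on another cycle, that cycle shares \<open>u\<close>
  and \<open>x\<close> with \<open>C\<close>; otherwise \<open>f\<close> contains \<open>u\<close>,
  and together with \<open>C\<close> it would produce a cycle through \<open>f\<close>.\<close>

lemma opposite_edge_disjoint:
  assumes "C \<in> cyc E" "c \<in> C" "u \<notin> c" "u \<in> \<Union>C" "f \<in> E" "f \<notin> C"
    and "\<And>D. D \<in> cyc E \<Longrightarrow> u \<in> \<Union>D" "\<And>e. e \<in> E - \<Union>(cyc E) \<Longrightarrow> u \<in> e"
  shows "disjnt c f"
proof (rule ccontr)
  assume "\<not> disjnt c f"
  then obtain x where x: "x \<in> c" "x \<in> f" by (auto simp: disjnt_iff)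
  then have "x \<noteq> u" using assms(3) by blast
  show False
  proof (cases "f \<in> \<Union>(cyc E)")
    case True
    then obtain D where D: "D \<in> cyc E" "f \<in> D" by blast
    then have "C = D"
      using separated_eq[OF assms(1) D(1), of x u] x assms(2,4,7) \<open>x \<noteq> u\<close> by blast
    then show False using D(2) assms(6) by blast
  next
    case False
    have "{f} \<inter> C = {}" using assms(6) by blast
    moreover have "D \<inter> {f} = {} \<or> D \<inter> C = {}" if "D \<in> cyc E" for D using False that by blast
    ultimately obtain r where r: "\<Union>C \<inter> \<Union>{f} \<subseteq> {r}"
      using assms(5) cyc_subset[OF assms(1)] cyc_conn[OF assms(1)]
      by (metis meet_at_most_once[of "{f}" C] conn_single empty_subsetI insert_subset)
    have "u \<in> f" using assms(5,8) False by blast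
    then have "u = r" "x = r" using r x assms(2,4) by blast+
    then show False using \<open>x \<noteq> u\<close> by simp
  qed
qed

end

text \<open>The map goes from the explicit \<open>L_graph\<close> to \<open>H\<close> and is defined
  edge by edge, with arbitrary enumerations of the leftover vertices. Its injectivity is not built
  in but deduced from counting, linearity and the preservation of disjointness.\<close>

theorem centre_isomorphic:
  fixes H :: "'a hypergraph"
  assumes "2 \<le> k" "1 \<le> m" "3 * t \<le> m" "H \<in> LCa k m t" "card {e \<in> edges H. u \<notin> e} \<le> t"
  shows "isomorphic H (L_graph k m t)"
proof -
  define E where "E = edges H"
  interpret linear_cactus E unfolding E_def by (rule LCa_linear_cactus[OF assms(1,4)])
  have H: "kgraph k H" "\<And>x y. x \<in> verts H \<Longrightarrow> y \<in> verts H \<Longrightarrow> (x, y) \<in> (adj E)\<^sup>*"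
    "card E = m" "card (cyc E) = t"
    using assms(4) by (auto simp: LCa_iff E_def)
  have card_k: "card e = k" and sub_verts: "e \<subseteq> verts H" if "e \<in> E" for e
    using H(1) that by (auto simp: kgraph_def E_def)

  obtain c where c: "\<And>C. C \<in> cyc E \<Longrightarrow> c C \<in> C" "\<And>C. C \<in> cyc E \<Longrightarrow> u \<notin> c C"
    "\<And>e. e \<in> E \<Longrightarrow> u \<notin> e \<Longrightarrow> \<exists>C\<in>cyc E. e = c C"
    "\<And>C. C \<in> cyc E \<Longrightarrow> \<forall>e\<in>C - {c C}. u \<in> e"
    by (rule centre_opposite_edges[of u]) (use assms(5) H(4) in \<open>auto simp: E_def\<close>)
  \<comment> \<open>Two edges and two vertices are packed into one tuple so that a single choice
    fixes them for each cycle.\<close>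
  define Q where "Q D q \<longleftrightarrow> (case q of (a, b, \<alpha>, \<beta>) \<Rightarrow> D = {a, c D, b} \<and> a \<noteq> c D \<and> a \<noteq> b \<and>
      b \<noteq> c D \<and> u \<in> a \<and> u \<in> b \<and> \<alpha> \<in> a \<and> \<alpha> \<in> c D \<and> \<beta> \<in> c D \<and> \<beta> \<in> b \<and> \<alpha> \<noteq> \<beta>)" for D q
  have "\<exists>q. Q D q" if D: "D \<in> cyc E" for D
  proof -
    obtain a b \<alpha> \<beta> where "D = {a, c D, b}" "a \<noteq> c D" "a \<noteq> b" "b \<noteq> c D" "u \<in> a" "u \<in> b"
      "\<alpha> \<in> a" "\<alpha> \<in> c D" "\<beta> \<in> c D" "\<beta> \<in> b" "\<alpha> \<noteq> \<beta>"
      by (rule triangle_through[OF D c(1)[OF D] c(2)[OF D] c(4)[OF D]])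
    then show ?thesis by (intro exI[of _ "(a, b, \<alpha>, \<beta>)"]) (simp add: Q_def)
  qed
  then have "\<forall>D\<in>cyc E. \<exists>q. Q D q" by blast
  from bchoice[OF this] obtain q where q: "\<forall>D\<in>cyc E. Q D (q D)" by blast
  define a where "a D = fst (q D)" for D
  define b where "b D = fst (snd (q D))" for D
  define \<alpha> where "\<alpha> D = fst (snd (snd (q D)))" for D
  define \<beta> where "\<beta> D = snd (snd (snd (q D)))" for D
  have T: "D = {a D, c D, b D}" "a D \<noteq> c D" "a D \<noteq> b D" "b D \<noteq> c D"
    "u \<in> a D" "u \<in> b D" "\<alpha> D \<in> a D" "\<alpha> D \<in> c D" "\<beta> D \<in> c D" "\<beta> D \<in> b D" "\<alpha> D \<noteq> \<beta> D"
    if "D \<in> cyc E" for D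
    using bspec[OF q that] unfolding Q_def a_def b_def \<alpha>_def \<beta>_def case_prod_beta by blast+
  have inE: "a C \<in> E" "c C \<in> E" "b C \<in> E" if "C \<in> cyc E" for C
    using cyc_subset[OF that] T(1)[OF that] by blast+
  have uT: "u \<in> \<Union>D" if "D \<in> cyc E" for D using T(1,5)[OF that] by blast
  define P where "P = E - \<Union>(cyc E)"
  have uP: "u \<in> e" if "e \<in> P" for e using c(1,3) that unfolding P_def by blast

  \<comment> \<open>Distinct cycles have no common edge, so the cycles use \<open>3 * t\<close>
    edges in all and \<open>m - 3 * t\<close> remain.\<close>
  have "pairwise disjnt (cyc E)" using cyc_eq unfolding pairwise_def disjnt_iff by blast
  then have "card (\<Union>(cyc E)) = sum card (cyc E)"
    using finite_subset[OF cyc_subset fin] by (intro card_Union_disjoint) auto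
  also have "\<dots> = 3 * t"
  proof -
    have "card C = 3" if "C \<in> cyc E" for C
    proof -
      have "card {a C, c C, b C} = 3" using T(2-4)[OF that] by auto
      then show ?thesis using T(1)[OF that] by simp
    qed
    then show ?thesis using H(4) by simp
  qed
  finally have cP: "card P = m - 3 * t"
    unfolding P_def using fin cyc_subset H(3) by (subst card_Diff_subset) (auto intro: finite_subset)
  have "finite P" using fin by (simp add: P_def)
  from enumerate_finite[OF this cP] obtain p where p: "p ` {..<m - 3 * t} = P" by blast
  obtain C where C: "C ` {..<t} = cyc E"
    using enumerate_finite[OF finite_cyc H(4)] by blast
  have Ci: "C i \<in> cyc E" if "i < t" for i using C that by blast
  have pi: "p i \<in> E" "u \<in> p i" if "i < m - 3 * t" for i
  proof -
    have "p i \<in> P" using p that by blast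
    then show "p i \<in> E" "u \<in> p i" using uP by (auto simp: P_def)
  qed

  have ne: "\<alpha> (C i) \<noteq> u" "\<beta> (C i) \<noteq> u" if "i < t" for i
    using T(8,9)[OF Ci[OF that]] c(2)[OF Ci[OF that]] by auto
  have leaves: "\<exists>h. h ` {..<k - 2} = e - {x, y}" if "e \<in> E" "x \<in> e" "y \<in> e" "x \<noteq> y" for e x y
  proof -
    have "card (e - {x, y}) = k - 2"
      using that card_k[OF that(1)] edge_finite[OF that(1)] by (subst card_Diff_subset) auto
    then show ?thesis using enumerate_finite[of "e - {x, y}"] edge_finite[OF that(1)] by (metis finite_Diff)
  qed
  have "\<exists>h. i < t \<longrightarrow> h ` {..<k - 2} = a (C i) - {u, \<alpha> (C i)}" for i
    using leaves[OF inE(1)[OF Ci] T(5,7)[OF Ci]] ne(1)[of i] by (cases "i < t") auto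
  then obtain h1 where h1: "\<And>i. i < t \<Longrightarrow> h1 i ` {..<k - 2} = a (C i) - {u, \<alpha> (C i)}" by metis
  have "\<exists>h. i < t \<longrightarrow> h ` {..<k - 2} = c (C i) - {\<alpha> (C i), \<beta> (C i)}" for i
    using leaves[OF inE(2)[OF Ci] T(8,9,11)[OF Ci]] by (cases "i < t") auto
  then obtain h2 where h2: "\<And>i. i < t \<Longrightarrow> h2 i ` {..<k - 2} = c (C i) - {\<alpha> (C i), \<beta> (C i)}" by metis
  have "\<exists>h. i < t \<longrightarrow> h ` {..<k - 2} = b (C i) - {\<beta> (C i), u}" for i
    using leaves[OF inE(3)[OF Ci] T(10,6)[OF Ci] ne(2)] by (cases "i < t") auto
  then obtain h3 where h3: "\<And>i. i < t \<Longrightarrow> h3 i ` {..<k - 2} = b (C i) - {\<beta> (C i), u}" by metis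
  have "\<exists>h. i < m - 3 * t \<longrightarrow> h ` {..<k - 1} = p i - {u}" for i
  proof (cases "i < m - 3 * t")
    case True
    then have "card (p i - {u}) = k - 1" using pi card_k by simp
    moreover have "finite (p i - {u})" using pi(1)[OF True] edge_finite by simp
    ultimately show ?thesis using enumerate_finite by metis
  qed simp
  then obtain h4 where h4: "\<And>i. i < m - 3 * t \<Longrightarrow> h4 i ` {..<k - 1} = p i - {u}" by metis

  define g where "g x = (case x of VertU \<Rightarrow> u | VertA i \<Rightarrow> \<alpha> (C i) | VertB i \<Rightarrow> \<beta> (C i)
    | CycleLeaf i j l \<Rightarrow> (if j = 1 then h1 i l else if j = 2 then h2 i l else h3 i l)
    | PendantLeaf i l \<Rightarrow> h4 i l)" for x
  let ?L = "L_edges k m t"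
  have g1: "g ` rim1 k i = a (C i)" if "i < t" for i
    using h1[OF that] T(5,7)[OF Ci[OF that]] by (auto simp: rim1_def g_def image_Un image_image)
  have g2: "g ` rim2 k i = c (C i)" if "i < t" for i
    using h2[OF that] T(8,9)[OF Ci[OF that]] by (auto simp: rim2_def g_def image_Un image_image)
  have g3: "g ` rim3 k i = b (C i)" if "i < t" for i
    using h3[OF that] T(6,10)[OF Ci[OF that]] by (auto simp: rim3_def g_def image_Un image_image)
  have g4: "g ` pendant k i = p i" if "i < m - 3 * t" for i
    using h4[OF that] pi(2)[OF that] by (auto simp: pendant_def g_def image_Un image_image)
  have "(`) g ` ?L = E"
  proof (intro equalityI subsetI)
    fix e assume "e \<in> (`) g ` ?L"
    then obtain d where d: "d \<in> ?L" "e = g ` d" by blast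
    from d(1) show "e \<in> E"
      by (rule L_edges_cases) (use d(2) inE Ci pi g1 g2 g3 g4 in auto)
  next
    fix e assume e: "e \<in> E"
    show "e \<in> (`) g ` ?L"
    proof (cases "e \<in> \<Union>(cyc E)")
      case True
      then obtain i where i: "i < t" "e \<in> C i" using C by blast
      then have "e \<in> {a (C i), c (C i), b (C i)}" using T(1)[OF Ci[OF i(1)]] by blast
      then have "e \<in> {g ` rim1 k i, g ` rim2 k i, g ` rim3 k i}"
        using g1[OF i(1)] g2[OF i(1)] g3[OF i(1)] by simp
      moreover have "rim1 k i \<in> ?L" "rim2 k i \<in> ?L" "rim3 k i \<in> ?L"
        using i(1) by (auto simp: L_edges_eq)
      ultimately show ?thesis by blast
    next
      case False
      then have "e \<in> P" using e by (simp add: P_def)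
      then obtain i where i: "i < m - 3 * t" "e = p i" using p by blast
      moreover have "pendant k i \<in> ?L" using i(1) by (auto simp: L_edges_eq)
      ultimately show ?thesis using g4[OF i(1)] by (metis image_eqI)
    qed
  qed
  note img = this
  \<comment> \<open>A surjection between two families of \<open>m\<close> edges is injective; the
    same count with \<open>k\<close> vertices then works on each edge.\<close>
  have inj_edges: "inj_on ((`) g) ?L"
    by (rule eq_card_imp_inj_on[OF finite_L_edges])
      (simp add: img H(3) card_L_edges[OF assms(1,3)])
  have inj_edge: "inj_on g e" if e: "e \<in> ?L" for e
  proof (rule eq_card_imp_inj_on)
    have "card e = k" using e assms(1) by (auto elim!: L_edges_cases simp: card_L)
    moreover have "g ` e \<in> E" using img e by blast
    ultimately show "card (g ` e) = card e" using card_k by simp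
    show "finite e" using \<open>card e = k\<close> assms(1) by (intro card_ge_0_finite) simp
  qed
  have rim2_disjoint: "disjnt (g ` rim2 k i) (g ` f)"
    if i: "i < t" and f: "f \<in> ?L" "rim2 k i \<noteq> f" "disjnt (rim2 k i) f" for i f
  proof -
    have "f \<noteq> rim1 k i" "f \<noteq> rim3 k i"
      using f(3) VertA_L(1,2)[of i k i] VertB_L(2,3)[of i k i] unfolding disjnt_iff by blast+
    moreover have "rim1 k i \<in> ?L" "rim2 k i \<in> ?L" "rim3 k i \<in> ?L"
      using i by (auto simp: L_edges_eq)
    moreover have "g ` f \<noteq> g ` d" if "d \<in> ?L" "f \<noteq> d" for d
      using inj_on_eq_iff[OF inj_edges f(1) that(1)] that(2) by simp
    ultimately have "g ` f \<noteq> g ` rim1 k i" "g ` f \<noteq> g ` rim2 k i" "g ` f \<noteq> g ` rim3 k i"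
      using f(2)[symmetric] by simp_all
    then have "g ` f \<noteq> a (C i)" "g ` f \<noteq> c (C i)" "g ` f \<noteq> b (C i)"
      using g1[OF i] g2[OF i] g3[OF i] by simp_all
    then have "g ` f \<notin> {a (C i), c (C i), b (C i)}" by blast
    then have "g ` f \<notin> C i" unfolding T(1)[OF Ci[OF i], symmetric] .
    moreover have "g ` f \<in> E" using img f(1) by blast
    ultimately show ?thesis
      unfolding g2[OF i]
      by (intro opposite_edge_disjoint[OF Ci[OF i] c(1)[OF Ci[OF i]] c(2)[OF Ci[OF i]] uT[OF Ci[OF i]]]
          uT uP) (simp_all add: P_def)
  qed
  \<comment> \<open>Two disjoint edges cannot both contain \<open>VertU\<close>, so one of them is a
    \<open>rim2\<close> edge.\<close>
  have disj: "disjnt (g ` e) (g ` f)" if ef: "e \<in> ?L" "f \<in> ?L" "e \<noteq> f" "disjnt e f" for e f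
  proof -
    have "VertU \<notin> e \<or> VertU \<notin> f" using ef(4) by (auto simp: disjnt_iff)
    then have "(\<exists>i<t. e = rim2 k i) \<or> (\<exists>i<t. f = rim2 k i)"
      using ef(1,2) by (auto elim!: L_edges_cases)
    then show ?thesis using rim2_disjoint ef disjnt_sym by metis
  qed
  \<comment> \<open>Vertices with equal images lie in edges \<open>e\<close>, \<open>f\<close> that
    cannot be disjoint. If \<open>e\<close> and \<open>f\<close> differ, linearity in
    \<open>H\<close> forces both images to be that of a common vertex \<open>z\<close>, and
    injectivity on \<open>e\<close> and on \<open>f\<close> gives \<open>x = z = y\<close>.\<close>
  have inj: "inj_on g (\<Union>?L)"
  proof (rule inj_onI)
    fix x y assume "x \<in> \<Union>?L" "y \<in> \<Union>?L" and eq: "g x = g y"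
    then obtain e f where ef: "e \<in> ?L" "x \<in> e" "f \<in> ?L" "y \<in> f" by blast
    show "x = y"
    proof (cases "e = f")
      case True
      then show ?thesis using inj_onD[OF inj_edge[OF ef(1)] eq] ef by blast
    next
      case False
      have gx: "g x \<in> g ` e" "g x \<in> g ` f" using imageI[OF ef(2), of g] imageI[OF ef(4), of g] eq by simp_all
      then have "\<not> disjnt (g ` e) (g ` f)" unfolding disjnt_iff by blast
      then have "\<not> disjnt e f" using disj[OF ef(1,3) False] by blast
      then obtain z where z: "z \<in> e" "z \<in> f" unfolding disjnt_iff by blast
      have "g ` e \<noteq> g ` f" using inj_onD[OF inj_edges _ ef(1,3)] False by blast
      moreover have "g ` e \<in> E" "g ` f \<in> E" using img ef by blast+
      ultimately have gz: "g x = g z"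
        using linear_eq[of "g ` e" "g ` f" "g x" "g z"] gx imageI[OF z(1), of g] imageI[OF z(2), of g]
        by blast
      have "x = z" by (rule inj_onD[OF inj_edge[OF ef(1)] gz ef(2) z(1)])
      moreover have "y = z" by (rule inj_onD[OF inj_edge[OF ef(3)] _ ef(4) z(2)]) (use gz eq in simp)
      ultimately show ?thesis by simp
    qed
  qed
  have "VertU \<in> \<Union>?L"
  proof (cases "t = 0")
    case True
    then have "pendant k 0 \<in> ?L" using assms(2) by (auto simp: L_edges_eq)
    then show ?thesis using VertU_L(4) by blast
  next
    case False
    then have "rim1 k 0 \<in> ?L" by (auto simp: L_edges_eq)
    then show ?thesis using VertU_L(1) by blast
  qed
  then have VL: "verts (L_graph k m t) = \<Union>?L" by (auto simp: L_graph_def)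
  \<comment> \<open>There is at least one edge, so connectedness leaves no isolated vertex.\<close>
  have VH: "verts H = \<Union>E"
  proof
    obtain e where e: "e \<in> E" using H(3) assms(2) by fastforce
    obtain y where y: "y \<in> e" using edge_nonempty[OF e] by blast
    show "verts H \<subseteq> \<Union>E"
    proof
      fix x assume "x \<in> verts H"
      then have "(x, y) \<in> (adj E)\<^sup>*" using H(2) sub_verts[OF e] y by blast
      then show "x \<in> \<Union>E" by (rule converse_rtranclE) (use e y in \<open>auto simp: adj_def\<close>)
    qed
  qed (use sub_verts in blast)
  have "g ` \<Union>?L = \<Union>E" unfolding img[symmetric] by blast
  then have "bij_betw g (verts (L_graph k m t)) (verts H)"
    using inj VL VH by (simp add: bij_betw_def)
  then have "isomorphic (L_graph k m t) H"
    using img unfolding isomorphic_def edges_L_graph E_def by blast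
  moreover have "kgraph k (L_graph k m t)"
    using L_graph_LCa[OF assms(1,3)] by (simp add: LCa_iff)
  ultimately show ?thesis by (rule isomorphic_sym[rotated])
qed

text \<open>Maximality is relative to one vertex type, so it is asserted for \<open>L_graph\<close>
  over \<open>Lvertex\<close> and characterized over any infinite \<open>'a\<close>. On the right,
  \<open>kgraph k H\<close> excludes edges reaching outside \<open>verts H\<close>, where the map in
  \<open>isomorphic\<close> is unconstrained.\<close>

theorem theorem4p9:
  fixes k m t :: nat
  assumes "2 \<le> k" and "4 \<le> m" and "3 * t \<le> m"
    and "infinite (UNIV :: 'a set)"
  shows "maximizing k (LCa k m t) (L_graph k m t) \<and>
         (\<forall>H :: 'a hypergraph.
            maximizing k (LCa k m t) H \<longleftrightarrow> kgraph k H \<and> isomorphic H (L_graph k m t))"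
proof (intro conjI allI iffI)
  let ?L = "L_graph k m t"
  have m: "2 \<le> m" "1 \<le> m" using assms(2) by auto
  have L: "?L \<in> LCa k m t" by (rule L_graph_LCa[OF assms(1,3)])
  have kL: "kgraph k ?L" using L by (simp add: LCa_iff)
  note le = max_root_comparison(1)[OF assms(1) m(1) assms(3)]
  show "maximizing k (LCa k m t) ?L"
    using L by (auto simp: maximizing_def intro: le)
  fix H :: "'a hypergraph"
  {
    assume max: "maximizing k (LCa k m t) H"
    then have H: "H \<in> LCa k m t" by (simp add: maximizing_def)
    then show "kgraph k H" by (simp add: LCa_iff)
    \<comment> \<open>A copy of the extremal cactus over \<open>'a\<close> belongs to the family in
      which \<open>H\<close> is maximizing.\<close>
    obtain G :: "'a hypergraph" where G: "isomorphic ?L G"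
      using isomorphic_copy[OF _ assms(4), of ?L] kL by (auto simp: kgraph_def)
    have "max_root k ?L \<le> max_root k H"
      using isomorphic_LCa[OF L G] max by (auto simp: maximizing_def)
    then obtain u where "\<not> t < card {e \<in> edges H. u \<notin> e}"
      using max_root_comparison(2)[OF assms(1) m(1) assms(3) H] by fastforce
    then have "card {e \<in> edges H. u \<notin> e} \<le> t" by simp
    then show "isomorphic H ?L" by (rule centre_isomorphic[OF assms(1) m(2) assms(3) H])
  next
    assume H: "kgraph k H \<and> isomorphic H ?L"
    then have "isomorphic ?L H" using isomorphic_sym by blast
    from isomorphic_LCa[OF L this] show "maximizing k (LCa k m t) H"
      by (auto simp: maximizing_def intro: le)
  }
qed

end
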